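(* Let $K$ be a field, $S=K[x_1,\ldots,x_n]$, and let $I,J\subset S$ be two monomial ideals with $r=\operatorname{slength}(I)$, $\bar r=\operatorname{slength}(S/I)$, $s=\operatorname{slength}(J)$ and $\bar s=\operatorname{slength}(S/J)$. Then: \begin{enumerate} \item[(1)] $\operatorname{slength}(I\cap J)\leq rs$. \item[(2)] $\operatorname{slength}(I+J)\leq\min\{r+s\bar r,\;s+r\bar s\}$. \item[(3)] $\operatorname{slength}(S/(I+J))\leq\bar r\bar s$. \item[(4)] $\operatorname{slength}(S/(I\cap J))\leq\min\{\bar r+r\bar s,\;\bar s+s\bar r\}$. \end{enumerate}
   Context: Let $M$ be a finitely generated $\mathbb Z^n$-graded $S$-module, $S=K[x_1,\ldots,x_n]$. A Stanley decomposition of $M$ is a finite direct sum of $K$-vector spaces $\mathcal D: M=\bigoplus_{i=1}^r m_iK[Z_i]$, where each $m_i\in M$ is homogeneous, $Z_i\subset\{x_1,\ldots,x_n\}$, and $m_iK[Z_i]$ is a free $K[Z_i]$-module. Its length is $\operatorname{slength}(\mathcal D)=r$, and the Stanley length of $M$ is $\operatorname{slength}(M)=\min\{\operatorname{slength}(\mathcal D):\mathcal D\text{ is a Stanley decomposition of }M\}$. The zero module has the empty Stanley decomposition, so $\operatorname{slength}(0)=0$. *)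

theory Defs
  imports Complex_Main "HOL-Algebra.QuotRing" "HOL-Algebra.Module" "HOL-Library.Poly_Mapping"
begin

section \<open>The polynomial ring and its monomial ideals\<close>

text \<open>
  An exponent vector is a map \<^term>\<open>u\<close> of type \<^typ>\<open>'n \<Rightarrow>\<^sub>0 nat\<close>, and a polynomial is a finitely supported
  map from exponent vectors to coefficients.  For a finite type of variables \<^typ>\<open>'n\<close> with \<open>n\<close> elements
  the type below, with its class multiplication, is the polynomial ring
  \<open>S = K[x\<^sub>1, \<dots>, x\<^sub>n]\<close>; the monomial \<open>c x\<^sup>u\<close> is \<open>Poly_Mapping.single u c\<close>.
\<close>

type_synonym ('n, 'k) mpoly = "('n \<Rightarrow>\<^sub>0 nat) \<Rightarrow>\<^sub>0 'k"

definition poly_ring :: "('n, 'k::field) mpoly ring" where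
  "poly_ring = \<lparr>carrier = UNIV, mult = (*), one = 1, zero = 0, add = (+)\<rparr>"

definition monomial_ideal :: "('n, 'k::field) mpoly set \<Rightarrow> bool" where
  "monomial_ideal I \<longleftrightarrow> (\<exists>A. I = Idl\<^bsub>poly_ring\<^esub> ((\<lambda>u. Poly_Mapping.single u 1) ` A))"

text \<open>The subring \<open>K[Z]\<close> of \<open>S\<close>.\<close>

definition poly_subring :: "'n set \<Rightarrow> ('n, 'k::field) mpoly set" where
  "poly_subring Z = {f. \<forall>u \<in> Poly_Mapping.keys f. Poly_Mapping.keys u \<subseteq> Z}"

text \<open>The component of \<open>S\<close> of degree \<open>a \<in> \<int>\<^sup>n\<close>; it is zero unless \<open>a\<close> is nonnegative.\<close>

definition poly_component :: "('n \<Rightarrow> int) \<Rightarrow> ('n, 'k::field) mpoly set" where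
  "poly_component a = {f. \<forall>u \<in> Poly_Mapping.keys f. \<forall>i. int (Poly_Mapping.lookup u i) = a i}"


section \<open>Graded modules\<close>

record ('a, 'b, 'n) zn_module = "('a, 'b) module" +
  component :: "('n \<Rightarrow> int) \<Rightarrow> 'b set"

locale zn_graded_module = Module.module poly_ring M
  for M :: "(('n::finite, 'k::field) mpoly, 'm, 'n) zn_module" (structure) +
  assumes finitely_generated:
      "\<exists>G. finite G \<and> G \<subseteq> carrier M \<and>
        (\<forall>v \<in> carrier M. \<exists>c. v = (\<Oplus>\<^bsub>M\<^esub>g\<in>G. c g \<odot>\<^bsub>M\<^esub> g))"
    and component_subset: "component M a \<subseteq> carrier M"
    and component_zero: "\<zero>\<^bsub>M\<^esub> \<in> component M a"
    and component_add:
      "\<lbrakk>v \<in> component M a; w \<in> component M a\<rbrakk> \<Longrightarrow> v \<oplus>\<^bsub>M\<^esub> w \<in> component M a"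
    and component_smult:
      "v \<in> component M a \<Longrightarrow>
        Poly_Mapping.single u c \<odot>\<^bsub>M\<^esub> v \<in> component M (\<lambda>i. int (Poly_Mapping.lookup u i) + a i)"
    and component_direct:
      "v \<in> carrier M \<Longrightarrow>
        \<exists>!w. (\<forall>a. w a \<in> component M a) \<and> finite {a. w a \<noteq> \<zero>\<^bsub>M\<^esub>} \<and>
          v = (\<Oplus>\<^bsub>M\<^esub>a\<in>{a. w a \<noteq> \<zero>\<^bsub>M\<^esub>}. w a)"

definition homogeneous :: "('a, 'b, 'n) zn_module \<Rightarrow> 'b \<Rightarrow> bool" where
  "homogeneous M m \<longleftrightarrow> (\<exists>a. m \<in> component M a)"

definition ideal_module ::
    "('n, 'k::field) mpoly set \<Rightarrow> (('n, 'k) mpoly, ('n, 'k) mpoly, 'n) zn_module" where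
  "ideal_module I =
    \<lparr>carrier = I, mult = (*), one = 1, zero = 0, add = (+), smult = (*),
     component = (\<lambda>a. I \<inter> poly_component a)\<rparr>"

definition quotient_module ::
    "('n, 'k::field) mpoly set \<Rightarrow> (('n, 'k) mpoly, ('n, 'k) mpoly set, 'n) zn_module" where
  "quotient_module I =
    \<lparr>carrier = carrier (poly_ring Quot I), mult = mult (poly_ring Quot I),
     one = one (poly_ring Quot I), zero = zero (poly_ring Quot I), add = add (poly_ring Quot I),
     smult = (\<lambda>f X. (I +>\<^bsub>poly_ring\<^esub> f) \<otimes>\<^bsub>poly_ring Quot I\<^esub> X),
     component = (\<lambda>a. (\<lambda>f. I +>\<^bsub>poly_ring\<^esub> f) ` poly_component a)\<rparr>"


section \<open>Stanley decompositions and Stanley length\<close>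

text \<open>The subspace \<open>mK[Z]\<close> of \<open>M\<close>.\<close>

definition stanley_space ::
    "(('n, 'k::field) mpoly, 'm, 'n) zn_module \<Rightarrow> 'm \<Rightarrow> 'n set \<Rightarrow> 'm set" where
  "stanley_space M m Z = (\<lambda>f. f \<odot>\<^bsub>M\<^esub> m) ` poly_subring Z"

text \<open>\<open>N\<close> is free over the subring \<open>A\<close> of \<open>S\<close>, that is, it has a basis over \<open>A\<close>.
  The zero module is free, with empty basis.\<close>

definition free_over ::
    "(('n, 'k::field) mpoly, 'm, 'n) zn_module \<Rightarrow> ('n, 'k) mpoly set \<Rightarrow> 'm set \<Rightarrow> bool" where
  "free_over M A N \<longleftrightarrow>
    (\<exists>B \<subseteq> N.
      (\<forall>v \<in> N. \<exists>F c. finite F \<and> F \<subseteq> B \<and> c \<in> F \<rightarrow> A \<and> v = (\<Oplus>\<^bsub>M\<^esub>b\<in>F. c b \<odot>\<^bsub>M\<^esub> b)) \<and>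
      (\<forall>F c. finite F \<and> F \<subseteq> B \<and> c \<in> F \<rightarrow> A \<and> (\<Oplus>\<^bsub>M\<^esub>b\<in>F. c b \<odot>\<^bsub>M\<^esub> b) = \<zero>\<^bsub>M\<^esub> \<longrightarrow>
        (\<forall>b\<in>F. c b = 0)))"

text \<open>A decomposition is the list of its pairs \<open>(m\<^sub>i, Z\<^sub>i)\<close>; it is direct when every element
  of \<open>M\<close> is a sum of elements of the \<open>m\<^sub>iK[Z\<^sub>i]\<close> in exactly one way.\<close>

definition stanley_decomposition ::
    "(('n, 'k::field) mpoly, 'm, 'n) zn_module \<Rightarrow> ('m \<times> 'n set) list \<Rightarrow> bool" where
  "stanley_decomposition M D \<longleftrightarrow>
    (\<forall>(m, Z) \<in> set D. m \<in> carrier M \<and> homogeneous M m \<and>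
      free_over M (poly_subring Z) (stanley_space M m Z)) \<and>
    (\<forall>v \<in> carrier M.
      \<exists>!w. w \<in> (\<Pi>\<^sub>E i\<in>{..<length D}. stanley_space M (fst (D ! i)) (snd (D ! i))) \<and>
        v = (\<Oplus>\<^bsub>M\<^esub>i\<in>{..<length D}. w i))"

definition slength :: "(('n, 'k::field) mpoly, 'm, 'n) zn_module \<Rightarrow> nat" where
  "slength M = (LEAST r. \<exists>D. stanley_decomposition M D \<and> length D = r)"


section \<open>Ideals and quotients as graded modules\<close>

lemma cring_poly_ring: "cring (poly_ring :: ('n, 'k::field) mpoly ring)"
proof (rule cringI)
  have "\<exists>y. y + x = 0" for x :: "('n, 'k) mpoly"
    by (rule exI[of _ "- x"]) simp
  then show "abelian_group (poly_ring :: ('n, 'k) mpoly ring)"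
    by (intro abelian_groupI) (auto simp: poly_ring_def algebra_simps)
  show "comm_monoid (poly_ring :: ('n, 'k) mpoly ring)"
    by (rule comm_monoidI) (auto simp: poly_ring_def algebra_simps)
qed (auto simp: poly_ring_def algebra_simps)

lemma poly_ring_simps:
  "carrier poly_ring = UNIV" "mult poly_ring = (*)" "one poly_ring = 1"
  "zero poly_ring = 0" "add poly_ring = (+)"
  by (simp_all add: poly_ring_def)

lemma ideal_poly_ringI:
  fixes I :: "('n, 'k::field) mpoly set"
  assumes "0 \<in> I" "\<And>f g. f \<in> I \<Longrightarrow> g \<in> I \<Longrightarrow> f + g \<in> I" "\<And>f g. f \<in> I \<Longrightarrow> g * f \<in> I"
  shows "ideal I poly_ring"
proof (rule idealI)
  have inv: "inv\<^bsub>add_monoid poly_ring\<^esub> f = - f" for f :: "('n, 'k) mpoly"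
    using group.inv_equality[OF abelian_group.a_group[OF ring.is_abelian_group[OF
        cring.axioms(1)[OF cring_poly_ring]]], of "- f" f]
    by (simp add: poly_ring_simps)
  have "- f \<in> I" if "f \<in> I" for f
    using assms(3)[OF that, of "- 1"] by simp
  then show "subgroup I (add_monoid poly_ring)"
    by (intro subgroup.intro; (simp only: inv)?) (auto simp: poly_ring_simps assms)
qed (use assms in \<open>auto simp: poly_ring_simps mult.commute intro: cring.axioms cring_poly_ring\<close>)

lemma ideal_poly_ringD:
  fixes I :: "('n, 'k::field) mpoly set"
  assumes "ideal I poly_ring"
  shows "0 \<in> I" "f \<in> I \<Longrightarrow> g \<in> I \<Longrightarrow> f + g \<in> I" "f \<in> I \<Longrightarrow> g * f \<in> I" "f \<in> I \<Longrightarrow> - f \<in> I"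
    "f \<in> I \<Longrightarrow> g \<in> I \<Longrightarrow> f - g \<in> I"
proof -
  interpret ideal I poly_ring by fact
  show "0 \<in> I" using additive_subgroup.zero_closed[OF is_additive_subgroup]
    by (simp add: poly_ring_simps)
  have add: "f + g \<in> I" if "f \<in> I" "g \<in> I" for f g
    using additive_subgroup.a_closed[OF is_additive_subgroup that] by (simp add: poly_ring_simps)
  have mult: "g * f \<in> I" if "f \<in> I" for f g
    using I_l_closed[OF that] by (simp add: poly_ring_simps)
  have minus: "- f \<in> I" if "f \<in> I" for f
    using mult[OF that, of "- 1"] by simp
  show "f \<in> I \<Longrightarrow> g \<in> I \<Longrightarrow> f + g \<in> I" "f \<in> I \<Longrightarrow> g * f \<in> I" "f \<in> I \<Longrightarrow> - f \<in> I"
    by (fact add mult minus)+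
  show "f \<in> I \<Longrightarrow> g \<in> I \<Longrightarrow> f - g \<in> I"
    using add[OF _ minus, of f g] by simp
qed

lemma ideal_monomial_ideal: "monomial_ideal I \<Longrightarrow> ideal I poly_ring"
  using ring.genideal_ideal[OF cring.axioms(1)[OF cring_poly_ring]]
  by (auto simp: monomial_ideal_def poly_ring_simps)

lemma mpoly_eq_sum_monomials:
  "f = (\<Sum>u\<in>Poly_Mapping.keys f. Poly_Mapping.single u (Poly_Mapping.lookup f u))"
  by (rule poly_mapping_eqI)
    (auto simp: lookup_sum lookup_single when_def in_keys_iff sum.If_cases
      intro!: sum.neutral split: if_splits)

lemma monomial_ideal_keys:
  fixes A :: "('n \<Rightarrow>\<^sub>0 nat) set"
  assumes I: "I = Idl\<^bsub>poly_ring :: ('n, 'k::field) mpoly ring\<^esub> ((\<lambda>u. Poly_Mapping.single u 1) ` A)"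
    and f: "f \<in> I" and u: "u \<in> Poly_Mapping.keys f"
  shows "\<exists>a\<in>A. \<exists>v. u = v + a"
proof -
  let ?J = "{f :: ('n, 'k) mpoly. \<forall>u\<in>Poly_Mapping.keys f. \<exists>a\<in>A. \<exists>v. u = v + a}"
  have "ideal ?J poly_ring"
  proof (rule ideal_poly_ringI)
    show "f + g \<in> ?J" if "f \<in> ?J" "g \<in> ?J" for f g
      using that keys_add[of f g] by blast
    show "g * f \<in> ?J" if f: "f \<in> ?J" for f g
    proof (rule CollectI, rule ballI)
      fix u assume "u \<in> Poly_Mapping.keys (g * f)"
      then obtain v w where vw: "u = v + w" "w \<in> Poly_Mapping.keys f"
        using keys_mult[of g f] by blast
      then obtain a v' where "a \<in> A" "w = v' + a" using f by blast
      with vw show "\<exists>a\<in>A. \<exists>v. u = v + a"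
        by (intro bexI[of _ a] exI[of _ "v + v'"]) (auto simp: add.assoc)
    qed
  qed simp
  moreover have "(\<lambda>u. Poly_Mapping.single u 1) ` A \<subseteq> ?J"
    by (auto intro!: bexI exI[of _ 0])
  ultimately have "I \<subseteq> ?J"
    unfolding I genideal_def by blast
  with f u show ?thesis by blast
qed

lemma monomial_ideal_monomial:
  assumes "monomial_ideal I" "f \<in> I" "u \<in> Poly_Mapping.keys f"
  shows "Poly_Mapping.single u c \<in> I"
proof -
  obtain A where A: "I = Idl\<^bsub>poly_ring\<^esub> ((\<lambda>u. Poly_Mapping.single u 1) ` A)"
    using assms(1) by (auto simp: monomial_ideal_def)
  obtain a v where a: "a \<in> A" "u = v + a"
    using monomial_ideal_keys[OF A assms(2,3)] by blast
  have "Poly_Mapping.single a 1 \<in> I"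
    unfolding A genideal_def using a by auto
  then have "Poly_Mapping.single v c * Poly_Mapping.single a 1 \<in> I"
    by (rule ideal_poly_ringD(3)[OF ideal_monomial_ideal[OF assms(1)]])
  then show ?thesis by (simp add: mult_single a)
qed

lemma ideal_sum_closed:
  assumes "ideal I poly_ring" "\<And>x. x \<in> A \<Longrightarrow> f x \<in> I"
  shows "sum f A \<in> I"
  using assms(2)
  by (induction A rule: infinite_finite_induct) (auto simp: ideal_poly_ringD[OF assms(1)])

definition exponent_degree :: "('n \<Rightarrow>\<^sub>0 nat) \<Rightarrow> 'n \<Rightarrow> int" where
  "exponent_degree u = (\<lambda>i. int (Poly_Mapping.lookup u i))"

definition component_part :: "('n \<Rightarrow> int) \<Rightarrow> ('n, 'k::field) mpoly \<Rightarrow> ('n, 'k) mpoly" where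
  "component_part a f = Poly_Mapping.mapp (\<lambda>u c. c when exponent_degree u = a) f"

lemma poly_component_alt:
  "poly_component a = {f. \<forall>u\<in>Poly_Mapping.keys f. exponent_degree u = a}"
  by (auto simp: poly_component_def exponent_degree_def fun_eq_iff)

lemma lookup_component_part:
  "Poly_Mapping.lookup (component_part a f) u =
    (Poly_Mapping.lookup f u when exponent_degree u = a)"
  by (auto simp: component_part_def lookup_mapp when_def in_keys_iff)

lemma component_part_diff: "component_part a (f - g) = component_part a f - component_part a g"
  by (rule poly_mapping_eqI) (auto simp: lookup_component_part lookup_minus when_def)

lemma component_part_sum: "component_part a (sum f A) = (\<Sum>x\<in>A. component_part a (f x))"
  by (rule poly_mapping_eqI) (auto simp: lookup_component_part lookup_sum when_def)

lemma component_part_in: "component_part a f \<in> poly_component a"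
  by (auto simp: poly_component_alt in_keys_iff lookup_component_part when_def split: if_splits)

lemma component_part_component:
  "f \<in> poly_component b \<Longrightarrow> component_part a f = (f when b = a)"
  by (rule poly_mapping_eqI)
    (auto simp: lookup_component_part when_def poly_component_alt in_keys_iff)

lemma component_part_eq_0:
  "a \<notin> exponent_degree ` Poly_Mapping.keys f \<Longrightarrow> component_part a f = 0"
  by (rule poly_mapping_eqI) (auto simp: lookup_component_part when_def in_keys_iff)

lemma sum_component_part:
  assumes "finite D" "exponent_degree ` Poly_Mapping.keys f \<subseteq> D"
  shows "(\<Sum>a\<in>D. component_part a f) = f"
proof (rule poly_mapping_eqI)
  fix u
  have "(\<Sum>a\<in>D. Poly_Mapping.lookup (component_part a f) u) =
      (if exponent_degree u \<in> D then Poly_Mapping.lookup f u else 0)"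
    using assms(1) by (simp add: lookup_component_part when_def)
  also have "\<dots> = Poly_Mapping.lookup f u"
    using assms(2) by (auto simp flip: not_in_keys_iff_lookup_eq_zero)
  finally show "Poly_Mapping.lookup (\<Sum>a\<in>D. component_part a f) u = Poly_Mapping.lookup f u"
    by (simp add: lookup_sum)
qed

lemma monomial_ideal_component_part:
  assumes "monomial_ideal I" "f \<in> I"
  shows "component_part a f \<in> I"
proof -
  have "Poly_Mapping.keys (component_part a f) \<subseteq> Poly_Mapping.keys f"
    by (auto simp: component_part_def intro: subsetD[OF keys_mapp_subset])
  then show ?thesis
    by (subst mpoly_eq_sum_monomials)
      (auto intro!: ideal_sum_closed ideal_monomial_ideal monomial_ideal_monomial assms)
qed

lemma poly_component_mult:
  assumes "f \<in> poly_component a"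
  shows "Poly_Mapping.single u c * f \<in> poly_component (\<lambda>i. int (Poly_Mapping.lookup u i) + a i)"
proof -
  have "exponent_degree w = (\<lambda>i. int (Poly_Mapping.lookup u i) + a i)"
    if w: "w \<in> Poly_Mapping.keys (Poly_Mapping.single u c * f)" for w
  proof -
    obtain v where "w = u + v" "v \<in> Poly_Mapping.keys f"
      using subsetD[OF keys_mult w] by (auto split: if_splits)
    with assms show ?thesis
      by (auto simp: poly_component_alt exponent_degree_def lookup_add)
  qed
  then show ?thesis by (simp add: poly_component_alt)
qed

lemma poly_component_add:
  "f \<in> poly_component a \<Longrightarrow> g \<in> poly_component a \<Longrightarrow> f + g \<in> poly_component a"
  using keys_add[of f g] by (auto simp: poly_component_alt)

text \<open>Dickson's lemma.\<close>

lemma incseq_subseq_nat: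
  fixes f :: "nat \<Rightarrow> nat"
  shows "\<exists>r. strict_mono r \<and> incseq (f \<circ> r)"
proof -
  obtain r where r: "strict_mono r" "monoseq (f \<circ> r)"
    using seq_monosub[of f] by (auto simp: o_def)
  show ?thesis
  proof (cases "incseq (f \<circ> r)")
    case False
    then have dec: "decseq (f \<circ> r)" using r by (simp add: monoseq_iff)
    define m where "m = (LEAST x. x \<in> range (f \<circ> r))"
    have "m \<in> range (f \<circ> r)" unfolding m_def by (rule LeastI) (rule rangeI)
    then obtain N where N: "f (r N) = m" by auto
    have "m \<le> f (r n)" for n unfolding m_def by (rule Least_le) auto
    moreover have "f (r (n + N)) \<le> m" for n
      using decseqD[OF dec, of N "n + N"] N by simp
    ultimately have "f (r (n + N)) = m" for n by (simp add: antisym)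
    then show ?thesis using r(1)
      by (intro exI[of _ "\<lambda>n. r (n + N)"]) (auto simp: strict_mono_def incseq_def)
  qed (use r in blast)
qed

lemma incseq_subseq_finite:
  fixes X :: "nat \<Rightarrow> 'n \<Rightarrow> nat"
  assumes "finite F"
  shows "\<exists>r. strict_mono r \<and> (\<forall>i\<in>F. incseq (\<lambda>k. X (r k) i))"
  using assms
proof induction
  case empty
  show ?case by (intro exI[of _ id]) (simp add: strict_mono_def)
next
  case (insert j F)
  then obtain r where r: "strict_mono r" "\<forall>i\<in>F. incseq (\<lambda>k. X (r k) i)" by blast
  obtain q where q: "strict_mono q" "incseq ((\<lambda>k. X (r k) j) \<circ> q)"
    using incseq_subseq_nat by blast
  have "strict_mono (r \<circ> q)" using r(1) q(1) by (rule strict_mono_o)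
  moreover have "incseq (\<lambda>k. X (r (q k)) i)" if "i \<in> F" for i
    using r(2) that strict_mono_mono[OF q(1)] by (auto simp: incseq_def mono_def)
  ultimately show ?case using q(2) by (intro exI[of _ "r \<circ> q"]) (auto simp: o_def)
qed

lemma dickson:
  fixes A :: "('n::finite \<Rightarrow>\<^sub>0 nat) set"
  shows "\<exists>B\<subseteq>A. finite B \<and> (\<forall>a\<in>A. \<exists>b\<in>B. \<exists>v. a = v + b)"
proof (rule ccontr)
  assume *: "\<not> ?thesis"
  have "\<exists>a. a \<in> A \<and> (\<forall>b\<in>B. \<nexists>v. a = v + b)" if "finite B" "B \<subseteq> A" for B
  proof (rule ccontr)
    assume "\<not> ?thesis"
    with that have "B \<subseteq> A \<and> finite B \<and> (\<forall>a\<in>A. \<exists>b\<in>B. \<exists>v. a = v + b)" by simp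
    then have "\<exists>B\<subseteq>A. finite B \<and> (\<forall>a\<in>A. \<exists>b\<in>B. \<exists>v. a = v + b)" by (rule exI)
    with * show False by (rule notE)
  qed
  then obtain g where g: "\<And>B. finite B \<Longrightarrow> B \<subseteq> A \<Longrightarrow> g B \<in> A \<and> (\<forall>b\<in>B. \<nexists>v. g B = v + b)"
    by metis
  define S where "S = rec_nat {} (\<lambda>_ B. insert (g B) B)"
  have S: "S 0 = {}" "S (Suc n) = insert (g (S n)) (S n)" for n by (simp_all add: S_def)
  have fin: "finite (S n) \<and> S n \<subseteq> A" for n
    by (induction n) (auto simp: S g)
  have sub: "m \<le> n \<Longrightarrow> S m \<subseteq> S n" for m n
    by (rule lift_Suc_mono_le[of S]) (auto simp: S)
  define x where "x n = g (S n)" for n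
  have bad: "\<nexists>v. x n = v + x m" if "m < n" for m n
  proof -
    have "x m \<in> S n" using sub[of "Suc m" n] that by (auto simp: S x_def)
    then show ?thesis using g[of "S n"] fin[of n] by (auto simp: x_def)
  qed
  obtain r where r: "strict_mono r" "\<forall>i\<in>UNIV. incseq (\<lambda>k. Poly_Mapping.lookup (x (r k)) i)"
    using incseq_subseq_finite[of UNIV "\<lambda>k. Poly_Mapping.lookup (x k)"] by auto
  have le: "Poly_Mapping.lookup (x (r 0)) i \<le> Poly_Mapping.lookup (x (r 1)) i" for i
    using r(2) by (simp add: incseq_def)
  have "x (r 1) = (x (r 1) - x (r 0)) + x (r 0)"
    by (rule poly_mapping_eqI) (simp add: lookup_add lookup_minus le[simplified])
  moreover have "r 0 < r 1" using r(1) by (simp add: strict_mono_def)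
  ultimately show False using bad by blast
qed

lemma monomial_ideal_finitely_generated:
  fixes I :: "('n::finite, 'k::field) mpoly set"
  assumes "monomial_ideal I"
  shows "\<exists>G. finite G \<and> G \<subseteq> I \<and> (\<forall>f\<in>I. \<exists>c. f = (\<Sum>g\<in>G. c g * g))"
proof -
  obtain A where A: "I = Idl\<^bsub>poly_ring\<^esub> ((\<lambda>u. Poly_Mapping.single u 1) ` A)"
    using assms by (auto simp: monomial_ideal_def)
  obtain B where B: "B \<subseteq> A" "finite B" "\<And>a. a \<in> A \<Longrightarrow> \<exists>b\<in>B. \<exists>v. a = v + b"
    using dickson by metis
  define G where "G = (\<lambda>u. Poly_Mapping.single u (1::'k)) ` B"
  let ?P = "\<lambda>f. \<exists>c. f = (\<Sum>g\<in>G. c g * g)"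
  have fin: "finite G" using B by (simp add: G_def)
  have add: "?P (f + h)" if fh: "?P f" "?P h" for f h
  proof -
    obtain c d where "f = (\<Sum>g\<in>G. c g * g)" "h = (\<Sum>g\<in>G. d g * g)" using fh by blast
    then show ?thesis
      by (intro exI[of _ "\<lambda>g. c g + d g"]) (simp add: distrib_right sum.distrib)
  qed
  have zero: "?P 0" by (rule exI[of _ "\<lambda>_. 0"]) simp
  have "?P f" if f: "f \<in> I" for f
  proof -
    have mono: "?P (Poly_Mapping.single u e)" if u: "u \<in> Poly_Mapping.keys f" for u e
    proof -
      obtain a v where "a \<in> A" "u = v + a" using monomial_ideal_keys[OF A f u] by blast
      moreover then obtain b v' where b: "b \<in> B" "a = v' + b" using B(3) by blast
      ultimately have "Poly_Mapping.single u e =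
          Poly_Mapping.single (v + v') e * Poly_Mapping.single b 1"
        by (simp add: mult_single add.assoc)
      also have "\<dots> = (\<Sum>g\<in>G. (if g = Poly_Mapping.single b 1
          then Poly_Mapping.single (v + v') e else 0) * g)"
        using fin b by (simp add: if_distrib[of "\<lambda>x. x * _"] G_def cong: if_cong)
      finally show ?thesis
        by (intro exI[of _ "\<lambda>g. if g = Poly_Mapping.single b 1
          then Poly_Mapping.single (v + v') e else 0"])
    qed
    have "?P (\<Sum>u\<in>U. Poly_Mapping.single u (Poly_Mapping.lookup f u))"
      if "finite U" "U \<subseteq> Poly_Mapping.keys f" for U
      using that
    proof induction
      case (insert u U)
      then show ?case using add[OF mono] by simp
    qed (use zero in simp)
    from this[of "Poly_Mapping.keys f"] show ?thesis
      using mpoly_eq_sum_monomials[of f] by simp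
  qed
  moreover have "G \<subseteq> I" unfolding A genideal_def G_def using B by auto
  ultimately show ?thesis using fin by blast
qed

context
  fixes I :: "('n::finite, 'k::field) mpoly set"
  assumes I: "monomial_ideal I"
begin

lemma module_ideal_module: "Module.module poly_ring (ideal_module I)"
proof (rule moduleI)
  note D = ideal_poly_ringD[OF ideal_monomial_ideal[OF I]]
  have "\<exists>y\<in>I. y + x = 0" if "x \<in> I" for x
    using D(4)[OF that] by (intro bexI[of _ "- x"]) auto
  then show "abelian_group (ideal_module I)"
    by (intro abelian_groupI) (auto simp: ideal_module_def D algebra_simps)
qed (auto simp: ideal_module_def poly_ring_simps algebra_simps cring_poly_ring
      ideal_poly_ringD[OF ideal_monomial_ideal[OF I]])

lemma finsum_ideal_module:
  assumes "\<And>x. x \<in> A \<Longrightarrow> f x \<in> I"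
  shows "(\<Oplus>\<^bsub>ideal_module I\<^esub>x\<in>A. f x) = sum f A"
proof -
  interpret Module.module poly_ring "ideal_module I" by (rule module_ideal_module)
  have s: "carrier (ideal_module I) = I" "zero (ideal_module I) = 0" "add (ideal_module I) = (+)"
    by (simp_all add: ideal_module_def)
  show ?thesis
    using assms
  proof (induction A rule: infinite_finite_induct)
    case (infinite A)
    then show ?case by (simp add: finsum_def finprod_def s)
  next
    case (insert x A)
    then have "(\<Oplus>\<^bsub>ideal_module I\<^esub>x\<in>insert x A. f x) = f x + (\<Oplus>\<^bsub>ideal_module I\<^esub>x\<in>A. f x)"
      by (subst M.finsum_insert) (auto simp: s)
    with insert show ?case by simp
  qed (simp add: s)
qed

lemma zn_graded_ideal_module: "zn_graded_module (ideal_module I)"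
proof (rule zn_graded_module.intro[OF module_ideal_module], unfold_locales)
  note idl = ideal_monomial_ideal[OF I]
  note D = ideal_poly_ringD[OF idl]
  have s: "carrier (ideal_module I) = I" "zero (ideal_module I) = 0" "add (ideal_module I) = (+)"
    "smult (ideal_module I) = (*)" "component (ideal_module I) a = I \<inter> poly_component a" for a
    by (simp_all add: ideal_module_def)
  show "\<exists>G. finite G \<and> G \<subseteq> carrier (ideal_module I) \<and> (\<forall>v\<in>carrier (ideal_module I).
      \<exists>c. v = (\<Oplus>\<^bsub>ideal_module I\<^esub>g\<in>G. c g \<odot>\<^bsub>ideal_module I\<^esub> g))"
  proof -
    obtain G where G: "finite G" "G \<subseteq> I" "\<forall>f\<in>I. \<exists>c. f = (\<Sum>g\<in>G. c g * g)"
      using monomial_ideal_finitely_generated[OF I] by blast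
    have "(\<Oplus>\<^bsub>ideal_module I\<^esub>g\<in>G. c g * g) = (\<Sum>g\<in>G. c g * g)" for c
      using G(2) by (intro finsum_ideal_module) (auto intro: D)
    with G show ?thesis by (auto simp: s)
  qed
  fix a
  show "component (ideal_module I) a \<subseteq> carrier (ideal_module I)" by (simp add: s)
  show "\<zero>\<^bsub>ideal_module I\<^esub> \<in> component (ideal_module I) a"
    by (simp add: s D poly_component_alt)
  show "v \<oplus>\<^bsub>ideal_module I\<^esub> w \<in> component (ideal_module I) a"
    if "v \<in> component (ideal_module I) a" "w \<in> component (ideal_module I) a" for v w
    using that by (simp add: s D poly_component_add)
  show "Poly_Mapping.single u c \<odot>\<^bsub>ideal_module I\<^esub> v
      \<in> component (ideal_module I) (\<lambda>i. int (Poly_Mapping.lookup u i) + a i)"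
    if "v \<in> component (ideal_module I) a" for u c v
    using that by (simp add: s D poly_component_mult)
next
  fix v assume "v \<in> carrier (ideal_module I)"
  then have v: "v \<in> I" by (simp add: ideal_module_def)
  have s: "carrier (ideal_module I) = I" "zero (ideal_module I) = 0" 
    "component (ideal_module I) a = I \<inter> poly_component a" for a
    by (simp_all add: ideal_module_def)
  show "\<exists>!w. (\<forall>a. w a \<in> component (ideal_module I) a) \<and> finite {a. w a \<noteq> \<zero>\<^bsub>ideal_module I\<^esub>} \<and>
          v = (\<Oplus>\<^bsub>ideal_module I\<^esub>a\<in>{a. w a \<noteq> \<zero>\<^bsub>ideal_module I\<^esub>}. w a)"
  proof (rule ex1I[of _ "\<lambda>a. component_part a v"], intro conjI allI)
    let ?D = "exponent_degree ` Poly_Mapping.keys v"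
    show "component_part a v \<in> component (ideal_module I) a" for a
      by (simp add: s component_part_in monomial_ideal_component_part I v)
    have sub: "{a. component_part a v \<noteq> 0} \<subseteq> ?D" using component_part_eq_0[of _ v] by blast
    then show "finite {a. component_part a v \<noteq> \<zero>\<^bsub>ideal_module I\<^esub>}"
      unfolding s by (rule finite_subset) simp
    have "(\<Sum>a\<in>{a. component_part a v \<noteq> 0}. component_part a v) = (\<Sum>a\<in>?D. component_part a v)"
      by (rule sum.mono_neutral_left) (use sub in auto)
    also have "\<dots> = v" by (rule sum_component_part) auto
    finally show "v = (\<Oplus>\<^bsub>ideal_module I\<^esub>a\<in>{a. component_part a v \<noteq> \<zero>\<^bsub>ideal_module I\<^esub>}. component_part a v)"
      by (subst finsum_ideal_module) (simp_all add: s monomial_ideal_component_part I v)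
  next
    fix w assume "(\<forall>a. w a \<in> component (ideal_module I) a) \<and> finite {a. w a \<noteq> \<zero>\<^bsub>ideal_module I\<^esub>} \<and>
          v = (\<Oplus>\<^bsub>ideal_module I\<^esub>a\<in>{a. w a \<noteq> \<zero>\<^bsub>ideal_module I\<^esub>}. w a)"
    then have w: "\<And>a. w a \<in> I" "\<And>a. w a \<in> poly_component a" "finite {a. w a \<noteq> 0}"
      "v = (\<Sum>a\<in>{a. w a \<noteq> 0}. w a)"
      by (simp_all add: s finsum_ideal_module)
    have "component_part b v = w b" for b
    proof -
      have "component_part b v = (\<Sum>a\<in>{a. w a \<noteq> 0}. if a = b then w a else 0)"
        by (subst w(4)) (simp add: component_part_sum component_part_component[OF w(2)] when_def)
      also have "\<dots> = w b" using w(3) by simp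
      finally show ?thesis .
    qed
    then show "w = (\<lambda>a. component_part a v)" by (simp add: fun_eq_iff)
  qed
qed

lemma coset_mem:
  "f \<in> I +>\<^bsub>poly_ring\<^esub> g \<longleftrightarrow> f - g \<in> I"
  by (force simp: a_r_coset_def' poly_ring_simps)

lemma coset_eq_iff:
  "I +>\<^bsub>poly_ring\<^esub> f = I +>\<^bsub>poly_ring\<^esub> g \<longleftrightarrow> f - g \<in> I"
proof
  note D = ideal_poly_ringD[OF ideal_monomial_ideal[OF I]]
  show "I +>\<^bsub>poly_ring\<^esub> f = I +>\<^bsub>poly_ring\<^esub> g \<Longrightarrow> f - g \<in> I"
    using coset_mem[of f f] coset_mem[of f g] D(1) by simp
  assume fg: "f - g \<in> I"
  have "h - f \<in> I \<longleftrightarrow> h - g \<in> I" for h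
    using D(2)[of "h - f" "f - g"] D(5)[of "h - g" "f - g"] fg by auto
  then show "I +>\<^bsub>poly_ring\<^esub> f = I +>\<^bsub>poly_ring\<^esub> g" by (auto simp: coset_mem)
qed

lemma quotient_module_simps:
  "carrier (quotient_module I) = range (\<lambda>f. I +>\<^bsub>poly_ring\<^esub> f)"
  "zero (quotient_module I) = I +>\<^bsub>poly_ring\<^esub> 0"
  "add (quotient_module I) (I +>\<^bsub>poly_ring\<^esub> f) (I +>\<^bsub>poly_ring\<^esub> g) = I +>\<^bsub>poly_ring\<^esub> (f + g)"
  "smult (quotient_module I) f (I +>\<^bsub>poly_ring\<^esub> g) = I +>\<^bsub>poly_ring\<^esub> (f * g)"
  "component (quotient_module I) a = (\<lambda>f. I +>\<^bsub>poly_ring\<^esub> f) ` poly_component a"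
proof -
  interpret ideal I poly_ring by (rule ideal_monomial_ideal[OF I])
  have [simp]: "zero (poly_ring Quot I) = I +>\<^bsub>poly_ring\<^esub> 0"
    using coset_mem[of _ 0] by (auto simp: FactRing_def)
  show "carrier (quotient_module I) = range (\<lambda>f. I +>\<^bsub>poly_ring\<^esub> f)"
    by (auto simp: quotient_module_def FactRing_def A_RCOSETS_def RCOSETS_def a_r_coset_def
        poly_ring_simps)
  show "zero (quotient_module I) = I +>\<^bsub>poly_ring\<^esub> 0" by (simp add: quotient_module_def)
  show "add (quotient_module I) (I +>\<^bsub>poly_ring\<^esub> f) (I +>\<^bsub>poly_ring\<^esub> g) = I +>\<^bsub>poly_ring\<^esub> (f + g)"
    using ring_hom_add[OF rcos_ring_hom, of f g] by (simp add: quotient_module_def poly_ring_simps)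
  show "smult (quotient_module I) f (I +>\<^bsub>poly_ring\<^esub> g) = I +>\<^bsub>poly_ring\<^esub> (f * g)"
    using ring_hom_mult[OF rcos_ring_hom, of f g] by (simp add: quotient_module_def poly_ring_simps)
  show "component (quotient_module I) a = (\<lambda>f. I +>\<^bsub>poly_ring\<^esub> f) ` poly_component a"
    by (simp add: quotient_module_def)
qed

lemma module_quotient_module: "Module.module poly_ring (quotient_module I)"
proof (rule moduleI)
  have "\<exists>y. I +>\<^bsub>poly_ring\<^esub> (y + x) = I +>\<^bsub>poly_ring\<^esub> 0" for x
    by (rule exI[of _ "- x"]) simp
  then show "abelian_group (quotient_module I)"
    by (intro abelian_groupI) (auto simp: quotient_module_simps algebra_simps)
qed (auto simp: quotient_module_simps poly_ring_simps algebra_simps cring_poly_ring)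

lemma finsum_quotient_module:
  "(\<Oplus>\<^bsub>quotient_module I\<^esub>x\<in>A. I +>\<^bsub>poly_ring\<^esub> f x) = I +>\<^bsub>poly_ring\<^esub> sum f A"
proof -
  interpret Module.module poly_ring "quotient_module I" by (rule module_quotient_module)
  show ?thesis
  proof (induction A rule: infinite_finite_induct)
    case (infinite A)
    then show ?case by (simp add: finsum_def finprod_def quotient_module_simps)
  next
    case (insert x A)
    then have "(\<Oplus>\<^bsub>quotient_module I\<^esub>x\<in>insert x A. I +>\<^bsub>poly_ring\<^esub> f x) =
        (I +>\<^bsub>poly_ring\<^esub> f x) \<oplus>\<^bsub>quotient_module I\<^esub> (\<Oplus>\<^bsub>quotient_module I\<^esub>x\<in>A. I +>\<^bsub>poly_ring\<^esub> f x)"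
      by (subst M.finsum_insert) (auto simp: quotient_module_simps)
    with insert show ?case by (simp add: quotient_module_simps)
  qed (simp add: quotient_module_simps)
qed

lemma zn_graded_quotient_module: "zn_graded_module (quotient_module I)"
proof (rule zn_graded_module.intro[OF module_quotient_module], unfold_locales)
  show "\<exists>G. finite G \<and> G \<subseteq> carrier (quotient_module I) \<and> (\<forall>v\<in>carrier (quotient_module I).
      \<exists>c. v = (\<Oplus>\<^bsub>quotient_module I\<^esub>g\<in>G. c g \<odot>\<^bsub>quotient_module I\<^esub> g))"
  proof (intro exI[of _ "{I +>\<^bsub>poly_ring\<^esub> 1}"] conjI ballI)
    interpret Module.module poly_ring "quotient_module I" by (rule module_quotient_module)
    fix v assume "v \<in> carrier (quotient_module I)"
    then obtain f where "v = I +>\<^bsub>poly_ring\<^esub> f" by (auto simp: quotient_module_simps)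
    then have "v = (\<Oplus>\<^bsub>quotient_module I\<^esub>g\<in>{I +>\<^bsub>poly_ring\<^esub> 1}. f \<odot>\<^bsub>quotient_module I\<^esub> g)"
      by (subst M.finsum_insert) (auto simp: quotient_module_simps)
    then show "\<exists>c. v = (\<Oplus>\<^bsub>quotient_module I\<^esub>g\<in>{I +>\<^bsub>poly_ring\<^esub> 1}. c g \<odot>\<^bsub>quotient_module I\<^esub> g)"
      by (rule exI[of _ "\<lambda>_. f"])
  qed (auto simp: quotient_module_simps)
  fix a
  show "component (quotient_module I) a \<subseteq> carrier (quotient_module I)"
    by (auto simp: quotient_module_simps)
  show "\<zero>\<^bsub>quotient_module I\<^esub> \<in> component (quotient_module I) a"
    by (auto simp: quotient_module_simps poly_component_alt)
  show "v \<oplus>\<^bsub>quotient_module I\<^esub> w \<in> component (quotient_module I) a"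
    if "v \<in> component (quotient_module I) a" "w \<in> component (quotient_module I) a" for v w
    using that by (auto simp: quotient_module_simps poly_component_add)
  show "Poly_Mapping.single u c \<odot>\<^bsub>quotient_module I\<^esub> v
      \<in> component (quotient_module I) (\<lambda>i. int (Poly_Mapping.lookup u i) + a i)"
    if "v \<in> component (quotient_module I) a" for u c v
    using that by (auto simp: quotient_module_simps poly_component_mult)
next
  note idl = ideal_monomial_ideal[OF I]
  fix v assume "v \<in> carrier (quotient_module I)"
  then obtain f where f: "v = I +>\<^bsub>poly_ring\<^esub> f" by (auto simp: quotient_module_simps)
  let ?c = "\<lambda>f. I +>\<^bsub>poly_ring\<^esub> f"
  show "\<exists>!w. (\<forall>a. w a \<in> component (quotient_module I) a) \<and>
      finite {a. w a \<noteq> \<zero>\<^bsub>quotient_module I\<^esub>} \<and>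
      v = (\<Oplus>\<^bsub>quotient_module I\<^esub>a\<in>{a. w a \<noteq> \<zero>\<^bsub>quotient_module I\<^esub>}. w a)"
  proof (rule ex1I[of _ "\<lambda>a. ?c (component_part a f)"], intro conjI allI)
    let ?D = "exponent_degree ` Poly_Mapping.keys f"
    let ?N = "{a. ?c (component_part a f) \<noteq> \<zero>\<^bsub>quotient_module I\<^esub>}"
    show "?c (component_part a f) \<in> component (quotient_module I) a" for a :: "'n \<Rightarrow> int"
      by (simp add: quotient_module_simps component_part_in)
    have sub: "?N \<subseteq> ?D"
      using component_part_eq_0[of _ f] by (auto simp: quotient_module_simps)
    then show "finite ?N" by (rule finite_subset) simp
    have "f = (\<Sum>a\<in>?D. component_part a f)" by (simp add: sum_component_part)
    also have "\<dots> = (\<Sum>a\<in>?N. component_part a f) + (\<Sum>a\<in>?D - ?N. component_part a f)"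
      using sum.subset_diff[OF sub, of "\<lambda>a. component_part a f"] by (simp add: add.commute)
    finally have "f - (\<Sum>a\<in>?N. component_part a f) = (\<Sum>a\<in>?D - ?N. component_part a f)"
      by (simp only: diff_eq_eq add.commute)
    also have "\<dots> \<in> I"
      by (rule ideal_sum_closed[OF idl]) (auto simp: quotient_module_simps coset_eq_iff)
    finally show "v = (\<Oplus>\<^bsub>quotient_module I\<^esub>a\<in>?N. ?c (component_part a f))"
      by (simp add: f finsum_quotient_module coset_eq_iff)
  next
    fix w :: "('n \<Rightarrow> int) \<Rightarrow> _"
    let ?N = "{a. w a \<noteq> \<zero>\<^bsub>quotient_module I\<^esub>}"
    assume w: "(\<forall>a. w a \<in> component (quotient_module I) a) \<and> finite ?N \<and>
      v = (\<Oplus>\<^bsub>quotient_module I\<^esub>a\<in>?N. w a)"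
    then have "\<forall>a :: 'n \<Rightarrow> int. \<exists>g. g \<in> poly_component a \<and> w a = ?c g"
      by (auto simp: quotient_module_simps)
    then obtain g where g: "\<And>a. g a \<in> poly_component a" "\<And>a. w a = ?c (g a)" by metis
    have "?c f = ?c (sum g ?N)" using w f by (simp add: g(2) finsum_quotient_module)
    then have fg: "f - sum g ?N \<in> I" by (simp add: coset_eq_iff)
    have "w b = ?c (component_part b f)" for b
    proof -
      have "component_part b (sum g ?N) = (\<Sum>a\<in>?N. if a = b then g a else 0)"
        by (simp add: component_part_sum component_part_component[OF g(1)] when_def)
      also have "\<dots> = (g b when b \<in> ?N)" using w by (simp add: when_def)
      finally have "component_part b f - (g b when b \<in> ?N) \<in> I"
        using monomial_ideal_component_part[OF I fg, of b] by (simp only: component_part_diff)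
      then have "?c (component_part b f) = ?c (g b when b \<in> ?N)"
        by (simp only: coset_eq_iff)
      also have "\<dots> = w b"
        by (cases "b \<in> ?N") (simp_all add: g(2)[symmetric] quotient_module_simps(2))
      finally show ?thesis by (rule sym)
    qed
    then show "w = (\<lambda>a. ?c (component_part a f))" by (simp add: fun_eq_iff)
  qed
qed

end

end

theory Submission
  imports Defs "HOL-Library.Disjoint_Sets"
begin

text \<open>
  A homogeneous element of a monomial ideal or of a quotient by one is a scalar multiple of a monomial
  (or zero), so its Stanley decompositions without zero terms are the partitions of the corresponding set of
  exponent vectors into cones \<open>u + \<nat>\<^sup>Z\<close>; freeness of \<open>mK[Z]\<close> says that the whole cone avoids the
  ideal that is divided out.  Two cones intersect in a cone or not at all, so common refinement of
  partitions yields the products \<open>rs\<close> and \<open>r's'\<close>, and the mixed bounds come from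
  \<open>E \<union> F = E \<union> (F - E)\<close> applied to the exponent sets or their complements.  The minimum that defines the
  Stanley length is attained because every monomial ideal and its complement do have such a partition.
\<close>

section \<open>Cones of exponent vectors\<close>

definition cone :: "('n \<Rightarrow>\<^sub>0 nat) \<Rightarrow> 'n set \<Rightarrow> ('n \<Rightarrow>\<^sub>0 nat) set" where
  "cone u Z = (\<lambda>v. v + u) ` {v. Poly_Mapping.keys v \<subseteq> Z}"

text \<open>\<open>partition_on\<close> excludes the empty set, so \<open>card P\<close> counts
  nonempty cones only, and a zero term of a Stanley decomposition leaves no trace in
  \<open>P\<close>.\<close>

definition cone_partition :: "('n \<Rightarrow>\<^sub>0 nat) set \<Rightarrow> ('n \<Rightarrow>\<^sub>0 nat) set set \<Rightarrow> bool" where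
  "cone_partition E P \<longleftrightarrow> finite P \<and> partition_on E P \<and> (\<forall>C\<in>P. \<exists>u Z. C = cone u Z)"

text \<open>These are the exponent sets of monomial ideals.\<close>

definition upward_closed :: "('n \<Rightarrow>\<^sub>0 nat) set \<Rightarrow> bool" where
  "upward_closed E \<longleftrightarrow> (\<forall>u\<in>E. \<forall>v. v + u \<in> E)"

lemma upward_closed_Int: "upward_closed E \<Longrightarrow> upward_closed F \<Longrightarrow> upward_closed (E \<inter> F)"
  and upward_closed_Un: "upward_closed E \<Longrightarrow> upward_closed F \<Longrightarrow> upward_closed (E \<union> F)"
  by (auto simp: upward_closed_def)

lemma exponent_le_imp_add:
  fixes u w :: "'n \<Rightarrow>\<^sub>0 nat"
  assumes "\<And>i. Poly_Mapping.lookup u i \<le> Poly_Mapping.lookup w i"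
  shows "w = (w - u) + u"
  by (rule poly_mapping_eqI) (simp add: lookup_add lookup_minus assms)

text \<open>Separate conditions on the single exponents allow intersections of cones and fibres of
  truncation to be treated one variable at a time.\<close>

lemma mem_cone_iff:
  "w \<in> cone u Z \<longleftrightarrow> (\<forall>i. Poly_Mapping.lookup u i \<le> Poly_Mapping.lookup w i) \<and>
    (\<forall>i. i \<notin> Z \<longrightarrow> Poly_Mapping.lookup w i = Poly_Mapping.lookup u i)"
  (is "_ \<longleftrightarrow> ?R")
proof
  assume "w \<in> cone u Z"
  then obtain v where v: "w = v + u" "Poly_Mapping.keys v \<subseteq> Z" by (auto simp: cone_def)
  then have "Poly_Mapping.lookup v i = 0" if "i \<notin> Z" for i
    using that by (auto simp flip: not_in_keys_iff_lookup_eq_zero)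
  with v show ?R by (simp add: lookup_add)
next
  assume R: ?R
  then have "w = (w - u) + u" by (intro exponent_le_imp_add) simp
  moreover have "Poly_Mapping.keys (w - u) \<subseteq> Z"
    using R by (auto simp: in_keys_iff lookup_minus)
  ultimately show "w \<in> cone u Z" unfolding cone_def by blast
qed

lemma cone_base: "u \<in> cone u Z"
  by (simp add: mem_cone_iff)

lemma exponent_exists:
  fixes f :: "'n::finite \<Rightarrow> nat"
  obtains t where "Poly_Mapping.lookup t = f"
proof (rule that)
  show "Poly_Mapping.lookup (Abs_poly_mapping f) = f" by (rule lookup_Abs_poly_mapping) simp
qed

section \<open>Intersections, common refinements and unions of cone partitions\<close>

text \<open>The base is the coordinatewise maximum of \<open>u\<close> and \<open>w\<close>; a
  variable stays free exactly when both cones leave it free. A common point makes the fixed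
  exponents compatible.\<close>

lemma cone_Int:
  fixes u w :: "'n::finite \<Rightarrow>\<^sub>0 nat"
  assumes "cone u Z \<inter> cone w W \<noteq> {}"
  shows "\<exists>t. cone u Z \<inter> cone w W = cone t (Z \<inter> W)"
proof -
  obtain x where x: "x \<in> cone u Z" "x \<in> cone w W" using assms by blast
  obtain t where t: "Poly_Mapping.lookup t =
      (\<lambda>i. max (Poly_Mapping.lookup u i) (Poly_Mapping.lookup w i))"
    by (rule exponent_exists)
  \<comment> \<open>For \<open>i\<close> outside \<open>Z\<close>, the common point \<open>x\<close>
    has the same exponent as \<open>u\<close>, so the exponent of \<open>w\<close> is at most that
    and the maximum is the fixed value; likewise for \<open>W\<close>.\<close>
  have *: "Poly_Mapping.lookup u i \<le> m \<and> (i \<notin> Z \<longrightarrow> m = Poly_Mapping.lookup u i) \<and>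
      Poly_Mapping.lookup w i \<le> m \<and> (i \<notin> W \<longrightarrow> m = Poly_Mapping.lookup w i) \<longleftrightarrow>
      Poly_Mapping.lookup t i \<le> m \<and> (i \<notin> Z \<inter> W \<longrightarrow> m = Poly_Mapping.lookup t i)" for m i
  proof -
    have "Poly_Mapping.lookup u i \<le> Poly_Mapping.lookup x i"
      "Poly_Mapping.lookup w i \<le> Poly_Mapping.lookup x i"
      "i \<notin> Z \<Longrightarrow> Poly_Mapping.lookup x i = Poly_Mapping.lookup u i"
      "i \<notin> W \<Longrightarrow> Poly_Mapping.lookup x i = Poly_Mapping.lookup w i"
      using x by (auto simp: mem_cone_iff)
    then show ?thesis by (cases "i \<in> Z"; cases "i \<in> W") (auto simp: t)
  qed
  have "y \<in> cone u Z \<inter> cone w W \<longleftrightarrow> y \<in> cone t (Z \<inter> W)" for y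
    using *[of _ "Poly_Mapping.lookup y _"] unfolding Int_iff mem_cone_iff by blast
  then show ?thesis by blast
qed

lemma cone_partition_Int:
  fixes E F :: "('n::finite \<Rightarrow>\<^sub>0 nat) set"
  assumes P: "cone_partition E P" and Q: "cone_partition F Q"
  shows "\<exists>R. cone_partition (E \<inter> F) R \<and> card R \<le> card P * card Q"
proof (intro exI conjI)
  \<comment> \<open>Disjoint pairs contribute the empty set, which is removed below; hence only an
    upper bound for the number of parts.\<close>
  let ?X = "(\<lambda>(C, D). C \<inter> D) ` (P \<times> Q)"
  have fin: "finite P" "finite Q" using P Q by (auto simp: cone_partition_def)
  have p: "\<Union>P = E" "\<Union>Q = F" "disjoint P" "disjoint Q"
    using P Q by (simp_all add: cone_partition_def partition_on_def)
  have "partition_on (E \<inter> F) (?X - {{}})"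
  proof (rule partition_onI)
    show "\<Union>(?X - {{}}) = E \<inter> F" unfolding p(1,2)[symmetric] by auto
    fix A B assume "A \<in> ?X - {{}}" "B \<in> ?X - {{}}" "A \<noteq> B"
    then obtain C D C' D' where AB: "A = C \<inter> D" "B = C' \<inter> D'"
      and CD: "C \<in> P" "D \<in> Q" "C' \<in> P" "D' \<in> Q" by auto
    with \<open>A \<noteq> B\<close> have "C \<noteq> C' \<or> D \<noteq> D'" by blast
    with AB CD show "disjnt A B"
      using disjointD[OF p(3)] disjointD[OF p(4)] unfolding disjnt_def by blast
  qed simp
  moreover have "\<exists>u Z. A = cone u Z" if "A \<in> ?X - {{}}" for A
  proof -
    from that obtain C D where A: "A = C \<inter> D" "C \<in> P" "D \<in> Q" "A \<noteq> {}" by auto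
    then obtain u Z w W where "C = cone u Z" "D = cone w W"
      using P Q by (meson cone_partition_def)
    then show ?thesis using cone_Int A by metis
  qed
  ultimately show "cone_partition (E \<inter> F) (?X - {{}})"
    using fin by (simp add: cone_partition_def)
  have "card (?X - {{}}) \<le> card ?X" using fin by (intro card_mono) auto
  also have "\<dots> \<le> card (P \<times> Q)" using fin by (intro card_image_le) auto
  finally show "card (?X - {{}}) \<le> card P * card Q" by (simp add: card_cartesian_product)
qed

lemma cone_partition_Un:
  assumes P: "cone_partition E P" and Q: "cone_partition F Q" and "E \<inter> F = {}"
  shows "cone_partition (E \<union> F) (P \<union> Q)"
proof -
  have p: "\<Union>P = E" "\<Union>Q = F" "disjoint P" "disjoint Q" "{} \<notin> P \<union> Q"
    using P Q by (simp_all add: cone_partition_def partition_on_def)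
  have "disjoint (P \<union> Q)" by (rule disjoint_union) (simp_all add: p assms(3))
  then have "partition_on (E \<union> F) (P \<union> Q)"
    using p by (simp add: partition_on_def)
  then show ?thesis using P Q by (simp add: cone_partition_def ball_Un)
qed

text \<open>
  Truncating all exponents at a large constant \<open>d\<close> preserves membership in an upward closed set,
  and the fibres of the truncation map are cones.
\<close>

lemma upward_closed_truncation:
  fixes E :: "('n::finite \<Rightarrow>\<^sub>0 nat) set"
  assumes E: "upward_closed E"
  obtains d where "\<And>u t. Poly_Mapping.lookup t = (\<lambda>i. min (Poly_Mapping.lookup u i) d)
    \<Longrightarrow> u \<in> E \<longleftrightarrow> t \<in> E"
proof -
  obtain B where B: "B \<subseteq> E" "finite B" "\<forall>a\<in>E. \<exists>b\<in>B. \<exists>v. a = v + b" using dickson by metis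
  \<comment> \<open>A bound for all exponents of the Dickson generators. If \<open>B\<close> is
    empty, \<open>Max\<close> is unspecified, but the bound is claimed for members of
    \<open>B\<close> only.\<close>
  define d where "d = Max ((\<lambda>(b, i). Poly_Mapping.lookup b i) ` (B \<times> UNIV))"
  have d: "Poly_Mapping.lookup b i \<le> d" if "b \<in> B" for b i
  proof -
    have "Poly_Mapping.lookup b i \<in> (\<lambda>(b, i). Poly_Mapping.lookup b i) ` (B \<times> UNIV)"
      using that by force
    then show ?thesis unfolding d_def using B(2) by (intro Max_ge) auto
  qed
  \<comment> \<open>Membership only compares \<open>u\<close> from below with exponents that are at
    most \<open>d\<close>, and truncation at \<open>d\<close> does not change the outcome of such
    comparisons.\<close>
  have iff: "u \<in> E \<longleftrightarrow> (\<exists>b\<in>B. \<forall>i. Poly_Mapping.lookup b i \<le> Poly_Mapping.lookup u i)" for u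
  proof
    assume "u \<in> E"
    then show "\<exists>b\<in>B. \<forall>i. Poly_Mapping.lookup b i \<le> Poly_Mapping.lookup u i"
      using B(3) by (force simp: lookup_add)
  next
    assume "\<exists>b\<in>B. \<forall>i. Poly_Mapping.lookup b i \<le> Poly_Mapping.lookup u i"
    then show "u \<in> E"
      using exponent_le_imp_add[of _ u] B(1) E unfolding upward_closed_def by (metis subsetD)
  qed
  show thesis
    by (rule that[of d]) (simp add: iff d)
qed

lemma cone_partition_truncation:
  fixes E :: "('n::finite \<Rightarrow>\<^sub>0 nat) set"
  assumes E: "\<And>u t. Poly_Mapping.lookup t = (\<lambda>i. min (Poly_Mapping.lookup u i) d)
    \<Longrightarrow> u \<in> E \<longleftrightarrow> t \<in> E"
  shows "\<exists>P. cone_partition E P"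
proof -
  \<comment> \<open>\<open>T\<close> holds the points of \<open>E\<close> fixed by truncation, one
    for each fibre; \<open>fibre t\<close> frees exactly the variables whose exponent has reached
    the cutoff \<open>d\<close>.\<close>
  define T where "T = {t \<in> E. \<forall>i. Poly_Mapping.lookup t i \<le> d}"
  define fibre where "fibre t = cone t {i. Poly_Mapping.lookup t i = d}" for t :: "'n \<Rightarrow>\<^sub>0 nat"
  have fibre: "u \<in> fibre t \<longleftrightarrow> Poly_Mapping.lookup t = (\<lambda>i. min (Poly_Mapping.lookup u i) d)"
    if "\<forall>i. Poly_Mapping.lookup t i \<le> d" for u t
  proof -
    have *: "Poly_Mapping.lookup t i = min m d \<longleftrightarrow> Poly_Mapping.lookup t i \<le> m \<and>
        (Poly_Mapping.lookup t i \<noteq> d \<longrightarrow> m = Poly_Mapping.lookup t i)" for i m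
      using that[rule_format, of i] by auto
    then show ?thesis unfolding fibre_def mem_cone_iff fun_eq_iff mem_Collect_eq * by blast
  qed
  have "finite (Poly_Mapping.lookup ` T)"
  proof (rule finite_subset)
    show "Poly_Mapping.lookup ` T \<subseteq> (UNIV :: 'n set) \<rightarrow>\<^sub>E {..d}" by (auto simp: T_def)
  qed (simp add: finite_PiE)
  then have "finite T" by (rule finite_imageD) (simp add: inj_on_def poly_mapping_eqI)
  moreover have "partition_on E (fibre ` T)"
  proof (rule partition_onI)
    show "\<Union>(fibre ` T) = E"
    proof (intro equalityI subsetI)
      fix u assume u: "u \<in> E"
      obtain t where t: "Poly_Mapping.lookup t = (\<lambda>i. min (Poly_Mapping.lookup u i) d)"
        by (rule exponent_exists)
      have "t \<in> E" using E[OF t] u by blast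
      then have "t \<in> T" by (simp add: T_def t)
      moreover have "u \<in> fibre t" using fibre[of t u] t by simp
      ultimately show "u \<in> \<Union>(fibre ` T)" by blast
    next
      fix u assume "u \<in> \<Union>(fibre ` T)"
      then obtain t where "t \<in> E" "\<forall>i. Poly_Mapping.lookup t i \<le> d" "u \<in> fibre t"
        by (auto simp: T_def)
      then show "u \<in> E" using E[of t u] fibre[of t u] by blast
    qed
    show "{} \<notin> fibre ` T" using cone_base unfolding fibre_def by blast
    fix A B assume AB: "A \<in> fibre ` T" "B \<in> fibre ` T" "A \<noteq> B"
    then obtain s t where st: "A = fibre s" "B = fibre t" "s \<in> T" "t \<in> T" by blast
    show "disjnt A B"
    proof (rule ccontr)
      assume "\<not> disjnt A B"
      \<comment> \<open>Both \<open>s\<close> and \<open>t\<close> are the truncation of the common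
        point \<open>u\<close>.\<close>
      then obtain u where "u \<in> fibre s" "u \<in> fibre t" using st by (auto simp: disjnt_iff)
      then have "Poly_Mapping.lookup s = Poly_Mapping.lookup t"
        using st fibre by (simp add: T_def)
      then show False using AB st by (simp add: poly_mapping_eqI)
    qed
  qed
  ultimately show ?thesis
    by (intro exI[of _ "fibre ` T"]) (auto simp: cone_partition_def fibre_def)
qed

text \<open>Invariance under truncation passes to the complement, so one construction partitions
  both sets.\<close>

lemma ex_cone_partition:
  fixes E :: "('n::finite \<Rightarrow>\<^sub>0 nat) set"
  assumes "upward_closed E"
  shows "\<exists>P. cone_partition E P" "\<exists>P. cone_partition (- E) P"
proof -
  obtain d where d: "\<And>u t. Poly_Mapping.lookup t = (\<lambda>i. min (Poly_Mapping.lookup u i) d)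
    \<Longrightarrow> u \<in> E \<longleftrightarrow> t \<in> E"
    using upward_closed_truncation[OF assms] by blast
  show "\<exists>P. cone_partition E P" "\<exists>P. cone_partition (- E) P"
    by (rule cone_partition_truncation[of d]; use d in blast)+
qed


section \<open>Polynomials with prescribed support\<close>

definition supported :: "('n \<Rightarrow>\<^sub>0 nat) set \<Rightarrow> ('n, 'k::field) mpoly set" where
  "supported E = {f. Poly_Mapping.keys f \<subseteq> E}"

definition restrict_poly :: "('n, 'k::field) mpoly \<Rightarrow> ('n \<Rightarrow>\<^sub>0 nat) set \<Rightarrow> ('n, 'k) mpoly" where
  "restrict_poly f E = Poly_Mapping.mapp (\<lambda>u c. c when u \<in> E) f"

lemma lookup_restrict_poly:
  "Poly_Mapping.lookup (restrict_poly f E) u = (Poly_Mapping.lookup f u when u \<in> E)"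
  by (auto simp: restrict_poly_def lookup_mapp when_def in_keys_iff)

lemma supported_iff: "f \<in> supported E \<longleftrightarrow> (\<forall>u. u \<notin> E \<longrightarrow> Poly_Mapping.lookup f u = 0)"
  by (auto simp: supported_def in_keys_iff)

lemma restrict_poly_supported: "restrict_poly f E \<in> supported E"
  by (simp add: supported_iff lookup_restrict_poly)

lemma supported_mono: "f \<in> supported E \<Longrightarrow> E \<subseteq> F \<Longrightarrow> f \<in> supported F"
  by (auto simp: supported_def)

lemma supported_0: "0 \<in> supported E"
  by (simp add: supported_def)

lemma supported_single: "u \<in> E \<Longrightarrow> Poly_Mapping.single u c \<in> supported E"
  by (simp add: supported_def)

lemma supported_add: "f \<in> supported E \<Longrightarrow> g \<in> supported E \<Longrightarrow> f + g \<in> supported E"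
  by (simp add: supported_iff lookup_add)

lemma supported_sum: "(\<And>i. i \<in> A \<Longrightarrow> f i \<in> supported E) \<Longrightarrow> sum f A \<in> supported E"
  by (simp add: supported_iff lookup_sum)

lemma supported_mult:
  assumes "upward_closed E" "g \<in> supported E"
  shows "f * g \<in> supported E"
  using assms keys_mult[of f g] by (fastforce simp: supported_def upward_closed_def)

lemma supported_disjoint: "f \<in> supported E \<Longrightarrow> f \<in> supported F \<Longrightarrow> E \<inter> F = {} \<Longrightarrow> f = 0"
  by (rule poly_mapping_eqI) (auto simp: supported_iff)

section \<open>Monomial ideals as spaces of prescribed support\<close>

text \<open>A monomial ideal contains every term of its elements, so the exponents of its monomials
  determine it. Conversely, upward closure gives closure under multiplication, and the monomials
  with exponent in \<open>E\<close> generate.\<close>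

lemma monomial_ideal_iff:
  fixes I :: "('n, 'k::field) mpoly set"
  shows "monomial_ideal I \<longleftrightarrow> (\<exists>E. upward_closed E \<and> I = supported E)"
proof
  assume I: "monomial_ideal I"
  note D = ideal_poly_ringD[OF ideal_monomial_ideal[OF I]]
  let ?E = "{u. Poly_Mapping.single u (1::'k) \<in> I}"
  have "Poly_Mapping.single (v + u) (1::'k) \<in> I" if "Poly_Mapping.single u (1::'k) \<in> I" for u v
    using D(3)[OF that, of "Poly_Mapping.single v 1"] by (simp add: mult_single)
  then have "upward_closed ?E" by (simp add: upward_closed_def)
  moreover have "f \<in> I" if f: "f \<in> supported ?E" for f
  proof (subst mpoly_eq_sum_monomials, rule ideal_sum_closed[OF ideal_monomial_ideal[OF I]])
    fix u assume "u \<in> Poly_Mapping.keys f"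
    with f have "Poly_Mapping.single u (1::'k) \<in> I" by (auto simp: supported_def)
    \<comment> \<open>Multiplication by a constant, written as a term of exponent \<open>0\<close>,
      restores the coefficient.\<close>
    from D(3)[OF this, of "Poly_Mapping.single 0 (Poly_Mapping.lookup f u)"]
    show "Poly_Mapping.single u (Poly_Mapping.lookup f u) \<in> I" by (simp add: mult_single)
  qed
  moreover have "f \<in> supported ?E" if "f \<in> I" for f
    using monomial_ideal_monomial[OF I that] by (simp add: supported_def subset_iff)
  ultimately have "upward_closed ?E" "I = supported ?E" by blast+
  then show "\<exists>E. upward_closed E \<and> I = supported E" by blast
next
  assume "\<exists>E. upward_closed E \<and> I = supported E"
  then obtain E where E: "upward_closed E" "I = supported E" by blast
  have idl: "ideal I poly_ring"
    using E by (intro ideal_poly_ringI) (auto simp: supported_0 supported_add supported_mult)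
  define G where "G = (\<lambda>u. Poly_Mapping.single u (1::'k)) ` E"
  let ?J = "Idl\<^bsub>poly_ring\<^esub> G"
  have J: "monomial_ideal ?J" by (auto simp: monomial_ideal_def G_def)
  note DJ = ideal_poly_ringD[OF ideal_monomial_ideal[OF J]]
  have GI: "G \<subseteq> I" using E by (auto simp: supported_single G_def)
  have "G \<subseteq> ?J" by (auto simp: genideal_def)
  have "f \<in> ?J" if f: "f \<in> I" for f
  proof (subst mpoly_eq_sum_monomials, rule ideal_sum_closed[OF ideal_monomial_ideal[OF J]])
    fix u assume "u \<in> Poly_Mapping.keys f"
    with f E have "Poly_Mapping.single u 1 \<in> ?J"
      using \<open>G \<subseteq> ?J\<close> by (auto simp: supported_def G_def)
    from DJ(3)[OF this, of "Poly_Mapping.single 0 (Poly_Mapping.lookup f u)"]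
    show "Poly_Mapping.single u (Poly_Mapping.lookup f u) \<in> ?J" by (simp add: mult_single)
  qed
  moreover have "?J \<subseteq> I" using idl GI by (auto simp: genideal_def)
  ultimately have "I = ?J" by blast
  then show "monomial_ideal I" using J by simp
qed

lemma supported_Int: "supported E \<inter> supported F = supported (E \<inter> F)"
  by (auto simp: supported_def)

lemma supported_set_add: "supported E <+>\<^bsub>poly_ring\<^esub> supported F = supported (E \<union> F)"
proof -
  have "\<exists>g\<in>supported E. \<exists>h\<in>supported F. f = g + h" if "f \<in> supported (E \<union> F)" for f
  proof (intro bexI)
    \<comment> \<open>\<open>F - E\<close> instead of \<open>F\<close>, so that exponents in both
      sets are counted once.\<close>
    show "f = restrict_poly f E + restrict_poly f (F - E)"
      by (rule poly_mapping_eqI) (use that in \<open>auto simp: lookup_add lookup_restrict_poly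
          supported_iff when_def\<close>)
    show "restrict_poly f (F - E) \<in> supported F"
      by (rule supported_mono[OF restrict_poly_supported]) blast
  qed (rule restrict_poly_supported)
  then show ?thesis
    by (auto simp: set_add_def' poly_ring_simps intro: supported_add supported_mono)
qed

section \<open>Multiplication by a monomial\<close>

text \<open>Adding \<open>u\<close> is injective on exponents, so no two terms of \<open>f\<close>
  merge.\<close>

lemma lookup_mult_monomial:
  fixes f :: "('n, 'k::field) mpoly"
  shows "Poly_Mapping.lookup (f * Poly_Mapping.single u c) (w + u) = Poly_Mapping.lookup f w * c"
proof -
  have "Poly_Mapping.lookup (f * Poly_Mapping.single u c) (w + u) = Poly_Mapping.lookup
      ((\<Sum>v\<in>Poly_Mapping.keys f. Poly_Mapping.single v (Poly_Mapping.lookup f v)) *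
        Poly_Mapping.single u c) (w + u)"
    by (simp flip: mpoly_eq_sum_monomials)
  also have "\<dots> = Poly_Mapping.lookup f w * c"
    by (auto simp: sum_distrib_right mult_single lookup_sum lookup_single when_def in_keys_iff)
  finally show ?thesis .
qed

lemma mult_monomial_eq_0_iff:
  fixes f :: "('n, 'k::field) mpoly"
  assumes "c \<noteq> 0"
  shows "f * Poly_Mapping.single u c = 0 \<longleftrightarrow> f = 0"
proof
  assume "f * Poly_Mapping.single u c = 0"
  then have "Poly_Mapping.lookup f w * c = 0" for w
    using lookup_mult_monomial[of f u c w] by simp
  then show "f = 0" using assms by (intro poly_mapping_eqI) simp
qed simp

text \<open>This links the subspaces \<open>mK[Z]\<close> to cones: from here on, Stanley spaces of
  monomials are handled through their supports.\<close>

lemma poly_subring_mult_monomial: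
  fixes u :: "'n \<Rightarrow>\<^sub>0 nat" and c :: "'k::field"
  assumes "c \<noteq> 0"
  shows "(\<lambda>f. f * Poly_Mapping.single u c) ` poly_subring Z = supported (cone u Z)"
proof (intro equalityI subsetI)
  fix g :: "('n, 'k) mpoly"
  assume "g \<in> (\<lambda>f. f * Poly_Mapping.single u c) ` poly_subring Z"
  then obtain f where "g = f * Poly_Mapping.single u c" "f \<in> poly_subring Z" by blast
  then have "Poly_Mapping.keys g \<subseteq> {v + u | v. v \<in> Poly_Mapping.keys f}"
    using keys_mult[of f "Poly_Mapping.single u c"] assms by simp
  then show "g \<in> supported (cone u Z)"
    using \<open>f \<in> poly_subring Z\<close> by (auto simp: supported_def poly_subring_def cone_def)
next
  fix g :: "('n, 'k) mpoly" assume g: "g \<in> supported (cone u Z)"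
  \<comment> \<open>The termwise quotient of \<open>g\<close> by the monomial. The truncated
    subtraction \<open>w - u\<close> is exact because every exponent of \<open>g\<close> lies in the
    cone.\<close>
  define f where "f = (\<Sum>w\<in>Poly_Mapping.keys g.
    Poly_Mapping.single (w - u) (Poly_Mapping.lookup g w / c))"
  have w: "w - u + u = w \<and> Poly_Mapping.keys (w - u) \<subseteq> Z" if "w \<in> Poly_Mapping.keys g" for w
  proof -
    have "w \<in> cone u Z" using g that by (auto simp: supported_def)
    then obtain v where "w = v + u" "Poly_Mapping.keys v \<subseteq> Z" by (auto simp: cone_def)
    then show ?thesis by simp
  qed
  have "f * Poly_Mapping.single u c =
      (\<Sum>w\<in>Poly_Mapping.keys g. Poly_Mapping.single w (Poly_Mapping.lookup g w))"
    using w assms unfolding f_def sum_distrib_right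
    by (intro sum.cong) (auto simp: mult_single)
  then have "g = f * Poly_Mapping.single u c" by (simp flip: mpoly_eq_sum_monomials)
  moreover have "f \<in> poly_subring Z"
  proof -
    have "\<exists>w\<in>Poly_Mapping.keys g. v = w - u" if "v \<in> Poly_Mapping.keys f" for v
      using subsetD[OF keys_sum that[unfolded f_def]] by (auto split: if_splits)
    then show ?thesis using w by (auto simp: poly_subring_def)
  qed
  ultimately show "g \<in> (\<lambda>f. f * Poly_Mapping.single u c) ` poly_subring Z" by blast
qed


section \<open>Monomial subquotients of the polynomial ring\<close>

lemma poly_subring_mult:
  assumes "f \<in> poly_subring Z" "g \<in> poly_subring Z"
  shows "f * g \<in> poly_subring Z"
  unfolding poly_subring_def
proof (intro CollectI ballI)
  fix w assume "w \<in> Poly_Mapping.keys (f * g)"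
  then obtain u v where "w = u + v" "u \<in> Poly_Mapping.keys f" "v \<in> Poly_Mapping.keys g"
    using keys_mult[of f g] by blast
  moreover from this have "Poly_Mapping.keys u \<subseteq> Z" "Poly_Mapping.keys v \<subseteq> Z"
    using assms by (auto simp: poly_subring_def)
  ultimately show "Poly_Mapping.keys w \<subseteq> Z" using keys_add[of u v] by blast
qed

text \<open>Freeness provides some basis, not necessarily the singleton of \<open>m\<close>. Expand
  \<open>m\<close> in it: multiplication by the monomial multiplies each coefficient, independence
  kills the products, and a monomial is no zero divisor, so the coefficients vanish.\<close>

lemma free_over_no_monomial_torsion:
  fixes M :: "(('n, 'k::field) mpoly, 'm, 'n) zn_module"
  assumes M: "Module.module poly_ring M"
    and free: "free_over M (poly_subring Z) N" and N: "N \<subseteq> carrier M" "m \<in> N"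
    and v: "Poly_Mapping.keys v \<subseteq> Z"
    and torsion: "Poly_Mapping.single v 1 \<odot>\<^bsub>M\<^esub> m = \<zero>\<^bsub>M\<^esub>"
  shows "m = \<zero>\<^bsub>M\<^esub>"
proof -
  interpret Module.module poly_ring M by fact
  let ?x = "Poly_Mapping.single v (1::'k)"
  obtain B where B: "B \<subseteq> N"
    and gen: "\<forall>v\<in>N. \<exists>F c. finite F \<and> F \<subseteq> B \<and> c \<in> F \<rightarrow> poly_subring Z \<and>
      v = (\<Oplus>\<^bsub>M\<^esub>b\<in>F. c b \<odot>\<^bsub>M\<^esub> b)"
    and indep: "\<forall>F c. finite F \<and> F \<subseteq> B \<and> c \<in> F \<rightarrow> poly_subring Z \<and>
      (\<Oplus>\<^bsub>M\<^esub>b\<in>F. c b \<odot>\<^bsub>M\<^esub> b) = \<zero>\<^bsub>M\<^esub> \<longrightarrow> (\<forall>b\<in>F. c b = 0)"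
    using free unfolding free_over_def by (elim exE conjE)
  obtain F c where F: "finite F" "F \<subseteq> B" "c \<in> F \<rightarrow> poly_subring Z"
    and m: "m = (\<Oplus>\<^bsub>M\<^esub>b\<in>F. c b \<odot>\<^bsub>M\<^esub> b)"
    using bspec[OF gen N(2)] by (elim exE conjE)
  have FM: "F \<subseteq> carrier M" using F(2) B N(1) by blast
  have x: "?x \<in> poly_subring Z" using v by (simp add: poly_subring_def)
  have "(\<Oplus>\<^bsub>M\<^esub>b\<in>F. (?x * c b) \<odot>\<^bsub>M\<^esub> b) = (\<Oplus>\<^bsub>M\<^esub>b\<in>F. ?x \<odot>\<^bsub>M\<^esub> (c b \<odot>\<^bsub>M\<^esub> b))"
  proof (rule M.finsum_cong')
    show "(?x * c b) \<odot>\<^bsub>M\<^esub> b = ?x \<odot>\<^bsub>M\<^esub> (c b \<odot>\<^bsub>M\<^esub> b)" if "b \<in> F" for b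
      using smult_assoc1[of ?x "c b" b] FM that by (auto simp: poly_ring_simps)
  qed (use FM in \<open>auto simp: poly_ring_simps\<close>)
  also have "\<dots> = ?x \<odot>\<^bsub>M\<^esub> m"
    unfolding m by (rule finsum_smult_ldistr[symmetric]) (use F(1) FM in \<open>auto simp: poly_ring_simps\<close>)
  also have "\<dots> = \<zero>\<^bsub>M\<^esub>" by (fact torsion)
  finally have sum: "(\<Oplus>\<^bsub>M\<^esub>b\<in>F. (?x * c b) \<odot>\<^bsub>M\<^esub> b) = \<zero>\<^bsub>M\<^esub>" .
  have coeffs: "(\<lambda>b. ?x * c b) \<in> F \<rightarrow> poly_subring Z"
    using F(3) x by (simp add: Pi_iff poly_subring_mult)
  have "\<forall>b\<in>F. ?x * c b = 0"
    by (rule indep[THEN spec, THEN spec, THEN mp], intro conjI F(1,2) coeffs sum)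
  then have "c b = 0" if "b \<in> F" for b
    using that mult_monomial_eq_0_iff[of "1::'k" "c b" v] by (simp add: mult.commute[of ?x])
  then have "m = (\<Oplus>\<^bsub>M\<^esub>b\<in>F. \<zero>\<^bsub>M\<^esub>)"
    unfolding m by (intro M.finsum_cong') (use FM smult_l_null in \<open>auto simp: poly_ring_simps\<close>)
  then show ?thesis by simp
qed

text \<open>
  A common model for ideals and quotients: \<open>p\<close> presents \<open>M\<close> as the quotient of the monomial ideal
  with exponents \<open>T\<close> by the one with exponents \<open>L\<close>, so \<open>M\<close> has the \<open>K\<close>-basis
  indexed by \<open>T - L\<close>.
\<close>

locale monomial_subquotient = Module.module poly_ring M
  for M :: "(('n::finite, 'k::field) mpoly, 'm, 'n) zn_module" (structure) +
  fixes p :: "('n, 'k) mpoly \<Rightarrow> 'm" and T L :: "('n \<Rightarrow>\<^sub>0 nat) set"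
  assumes upward: "upward_closed T" "upward_closed L"
    and carrier_eq: "carrier M = p ` supported T"
    and zero_eq: "\<zero>\<^bsub>M\<^esub> = p 0"
    and p_eq_iff: "\<lbrakk>f \<in> supported T; g \<in> supported T\<rbrakk> \<Longrightarrow> p f = p g \<longleftrightarrow> f - g \<in> supported L"
    and smult_p: "g \<in> supported T \<Longrightarrow> f \<odot>\<^bsub>M\<^esub> p g = p (f * g)"
    and add_p: "\<lbrakk>f \<in> supported T; g \<in> supported T\<rbrakk> \<Longrightarrow> p f \<oplus>\<^bsub>M\<^esub> p g = p (f + g)"
    and component_eq: "component M a = p ` (supported T \<inter> poly_component a)"
begin

lemma finsum_p:
  assumes "\<And>x. x \<in> A \<Longrightarrow> w x = p (h x)" "\<And>x. x \<in> A \<Longrightarrow> h x \<in> supported T"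
  shows "(\<Oplus>\<^bsub>M\<^esub>x\<in>A. w x) = p (sum h A)"
  using assms
proof (induction A rule: infinite_finite_induct)
  \<comment> \<open>Over an infinite index set both sums default to zero.\<close>
  case (infinite A)
  then show ?case by (simp add: finsum_def finprod_def zero_eq)
next
  case empty
  show ?case by (simp add: zero_eq)
next
  case (insert x A)
  have "w \<in> A \<rightarrow> carrier M" "w x \<in> carrier M"
    using insert.prems by (auto simp: carrier_eq)
  then have "(\<Oplus>\<^bsub>M\<^esub>x\<in>insert x A. w x) = p (h x) \<oplus>\<^bsub>M\<^esub> p (sum h A)"
    using M.finsum_insert[OF insert.hyps] insert by simp
  also have "\<dots> = p (h x + sum h A)"
    by (rule add_p) (use insert.prems in \<open>auto intro: supported_sum\<close>)
  finally show ?case using insert.hyps by simp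
qed

section \<open>Homogeneous elements and Stanley spaces in a subquotient\<close>

lemma p_single_eq_0_iff:
  assumes "u \<in> T" "c \<noteq> 0"
  shows "p (Poly_Mapping.single u c) = p 0 \<longleftrightarrow> u \<in> L"
  using assms by (auto simp: p_eq_iff supported_single supported_0 supported_iff lookup_single when_def)

lemma stanley_space_monomial:
  assumes "u \<in> T" "c \<noteq> 0"
  shows "stanley_space M (p (Poly_Mapping.single u c)) Z = p ` supported (cone u Z)"
  using assms(1)
  by (simp add: stanley_space_def smult_p supported_single image_image
      flip: poly_subring_mult_monomial[OF assms(2)])

text \<open>A zero generator is treated as a cone that is empty.\<close>

lemma stanley_space_zero: "stanley_space M (p 0) Z = p ` supported {}"
proof -
  have "(0 :: ('n, 'k) mpoly) \<in> poly_subring Z" by (simp add: poly_subring_def)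
  then show ?thesis by (auto simp: stanley_space_def smult_p supported_0 supported_def)
qed

text \<open>The grading is fine: a degree belongs to at most one exponent vector, so a homogeneous
  representative has at most one term, and that term maps to zero exactly when its exponent is in
  \<open>L\<close>.\<close>

lemma homogeneous_cases:
  assumes "homogeneous M m"
  obtains "m = p 0" | u c where "u \<in> T - L" "c \<noteq> 0" "m = p (Poly_Mapping.single u c)"
proof -
  obtain a f where m: "m = p f" and f: "f \<in> supported T" "f \<in> poly_component a"
    using assms by (auto simp: homogeneous_def component_eq)
  show thesis
  proof (cases "f = 0")
    case True
    then show ?thesis using m that(1) by simp
  next
    case False
    then obtain u where u: "u \<in> Poly_Mapping.keys f" by fastforce
    have "v = u" if "v \<in> Poly_Mapping.keys f" for v
    proof (rule poly_mapping_eqI)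
      fix i
      have "int (Poly_Mapping.lookup v i) = a i" "int (Poly_Mapping.lookup u i) = a i"
        using f(2) u that by (simp_all add: poly_component_def)
      then show "Poly_Mapping.lookup v i = Poly_Mapping.lookup u i" by simp
    qed
    then have "f = Poly_Mapping.single u (Poly_Mapping.lookup f u)"
      by (intro poly_mapping_eqI) (auto simp: lookup_single when_def in_keys_iff)
    moreover have "u \<in> T" "Poly_Mapping.lookup f u \<noteq> 0"
      using u f(1) by (auto simp: supported_def in_keys_iff)
    ultimately show ?thesis
      using that p_single_eq_0_iff m by (metis DiffI)
  qed
qed

text \<open>The set \<open>K\<close> is empty for a zero generator. Otherwise freeness excludes
  monomial torsion, so no monomial of \<open>K[Z]\<close> moves \<open>u\<close> into
  \<open>L\<close>; upward closure keeps the cone inside \<open>T\<close>.\<close>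

lemma free_stanley_space_cone:
  assumes "m \<in> carrier M" "homogeneous M m"
    and free: "free_over M (poly_subring Z) (stanley_space M m Z)"
  shows "\<exists>K. stanley_space M m Z = p ` supported K \<and> K \<subseteq> T - L \<and> (K = {} \<or> (\<exists>u. K = cone u Z))"
  using assms(2)
proof (cases rule: homogeneous_cases)
  case 1
  then show ?thesis using stanley_space_zero by blast
next
  case (2 u c)
  have N: "stanley_space M m Z \<subseteq> carrier M"
    using assms(1) by (auto simp: stanley_space_def poly_ring_simps)
  have one: "m \<in> stanley_space M m Z"
    using smult_one[OF assms(1)] unfolding stanley_space_def
    by (auto simp: poly_subring_def poly_ring_simps intro!: image_eqI[of _ _ 1])
  have "v + u \<in> T - L" if v: "Poly_Mapping.keys v \<subseteq> Z" for v
  proof -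
    have T: "v + u \<in> T" using 2(1) upward(1) by (simp add: upward_closed_def)
    have "m \<noteq> \<zero>\<^bsub>M\<^esub>" using 2 p_single_eq_0_iff zero_eq by auto
    then have "Poly_Mapping.single v 1 \<odot>\<^bsub>M\<^esub> m \<noteq> \<zero>\<^bsub>M\<^esub>"
      using free_over_no_monomial_torsion[OF module_axioms free N one v] by blast
    then have "p (Poly_Mapping.single (v + u) c) \<noteq> p 0"
      using 2 by (simp add: smult_p supported_single mult_single zero_eq)
    then show ?thesis using T p_single_eq_0_iff[OF T 2(2)] by blast
  qed
  then have "cone u Z \<subseteq> T - L" by (auto simp: cone_def)
  then show ?thesis using stanley_space_monomial 2 by blast
qed

text \<open>The generator alone is a basis: if \<open>f\<close> annihilates it, then
  \<open>f\<close> times the monomial is supported both in the cone and in \<open>L\<close>, which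
  are disjoint.\<close>

lemma free_over_cone:
  assumes cone: "cone u Z \<subseteq> T - L"
  shows "free_over M (poly_subring Z) (stanley_space M (p (Poly_Mapping.single u 1)) Z)"
proof -
  let ?m = "p (Poly_Mapping.single u 1)"
  let ?A = "poly_subring Z :: ('n, 'k) mpoly set"
  have u: "u \<in> T" "u \<in> T - L" using cone cone_base[of u Z] by auto
  then have m: "?m \<in> carrier M" by (simp add: carrier_eq supported_single)
  have one: "?m \<in> stanley_space M ?m Z"
    using smult_one[OF m] unfolding stanley_space_def
    by (auto simp: poly_subring_def poly_ring_simps intro!: image_eqI[of _ _ 1])
  have sum1: "(\<Oplus>\<^bsub>M\<^esub>b\<in>{?m}. c b \<odot>\<^bsub>M\<^esub> b) = c ?m \<odot>\<^bsub>M\<^esub> ?m" for c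
    using m by (subst M.finsum_insert) (auto simp: poly_ring_simps)
  have "f = 0" if f: "f \<in> ?A" and "f \<odot>\<^bsub>M\<^esub> ?m = \<zero>\<^bsub>M\<^esub>" for f
  proof -
    let ?g = "f * Poly_Mapping.single u 1"
    have g: "?g \<in> supported (cone u Z)"
      using f poly_subring_mult_monomial[of "1::'k" u Z] by auto
    have "p ?g = p 0"
      using that(2) u by (simp add: smult_p supported_single zero_eq)
    then have "?g \<in> supported L"
      using p_eq_iff[of ?g 0] supported_mono[OF g, of T] cone by (auto simp: supported_0)
    then have "?g = 0" using supported_disjoint[OF g] cone by blast
    then show ?thesis by (simp add: mult_monomial_eq_0_iff)
  qed
  \<comment> \<open>Independence ranges over all subsets \<open>F\<close> of the basis, here only
    the empty set and the singleton.\<close>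
  then have indep: "\<forall>b\<in>F. c b = 0"
    if "F \<subseteq> {?m}" "c \<in> F \<rightarrow> ?A" "(\<Oplus>\<^bsub>M\<^esub>b\<in>F. c b \<odot>\<^bsub>M\<^esub> b) = \<zero>\<^bsub>M\<^esub>" for F c
    using that sum1[of c] by (cases "F = {}") (auto simp: subset_singleton_iff)
  have gen: "\<exists>F c. finite F \<and> F \<subseteq> {?m} \<and> c \<in> F \<rightarrow> ?A \<and> v = (\<Oplus>\<^bsub>M\<^esub>b\<in>F. c b \<odot>\<^bsub>M\<^esub> b)"
    if v: "v \<in> stanley_space M ?m Z" for v
  proof -
    obtain f where "f \<in> ?A" "v = f \<odot>\<^bsub>M\<^esub> ?m" using v by (auto simp: stanley_space_def)
    then show ?thesis
      by (intro exI[of _ "{?m}"] exI[of _ "\<lambda>_. f"]) (simp add: sum1)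
  qed
  show ?thesis
    unfolding free_over_def
  proof (rule exI[of _ "{?m}"], intro conjI ballI allI impI)
    fix F c b
    assume "finite F \<and> F \<subseteq> {?m} \<and> c \<in> F \<rightarrow> ?A \<and> (\<Oplus>\<^bsub>M\<^esub>b\<in>F. c b \<odot>\<^bsub>M\<^esub> b) = \<zero>\<^bsub>M\<^esub>" "b \<in> F"
    then show "c b = 0" using indep by blast
  qed (use one in simp, rule gen)
qed

section \<open>Stanley decompositions and cone partitions\<close>

text \<open>Test the direct sum on single monomials: existence of an expansion makes the supports
  \<open>K i\<close> cover \<open>T - L\<close>, and uniqueness makes them disjoint.\<close>

lemma stanley_decomposition_imp_cone_partition:
  assumes D: "stanley_decomposition M D"
  shows "\<exists>P. cone_partition (T - L) P \<and> card P \<le> length D"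
proof -
  let ?n = "length D"
  let ?S = "\<lambda>i. stanley_space M (fst (D ! i)) (snd (D ! i))"
  have "\<exists>K. ?S i = p ` supported K \<and> K \<subseteq> T - L \<and> (K = {} \<or> (\<exists>u. K = cone u (snd (D ! i))))"
    if "i < ?n" for i
  proof -
    have "(fst (D ! i), snd (D ! i)) \<in> set D" using that by simp
    then show ?thesis
      using D unfolding stanley_decomposition_def by (intro free_stanley_space_cone) blast+
  qed
  then obtain K where K: "\<And>i. i < ?n \<Longrightarrow> ?S i = p ` supported (K i)"
    "\<And>i. i < ?n \<Longrightarrow> K i \<subseteq> T - L"
    "\<And>i. i < ?n \<Longrightarrow> K i = {} \<or> (\<exists>u. K i = cone u (snd (D ! i)))"
    by metis
  let ?W = "\<Pi>\<^sub>E i\<in>{..<?n}. ?S i"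
  have uniq: "\<exists>!w. w \<in> ?W \<and> v = (\<Oplus>\<^bsub>M\<^esub>i\<in>{..<?n}. w i)" if "v \<in> carrier M" for v
    using D that unfolding stanley_decomposition_def by blast
  have KT: "supported (K i) \<subseteq> supported T" if "i < ?n" for i
    using K(2)[OF that] by (auto simp: supported_def)
  \<comment> \<open>If no \<open>K i\<close> contains \<open>x\<close>, all summands of an expansion
    vanish at \<open>x\<close>, and so does the error in \<open>supported L\<close>; but
    \<open>?e\<close> has coefficient \<open>1\<close> there.\<close>
  have cover: "\<exists>i<?n. x \<in> K i" if x: "x \<in> T - L" for x
  proof (rule ccontr)
    assume no: "\<not> (\<exists>i<?n. x \<in> K i)"
    let ?e = "Poly_Mapping.single x (1::'k)"
    have e: "?e \<in> supported T" using x by (simp add: supported_single)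
    then obtain w where w: "w \<in> ?W" "p ?e = (\<Oplus>\<^bsub>M\<^esub>i\<in>{..<?n}. w i)"
      using uniq[of "p ?e"] unfolding carrier_eq by blast
    have "\<exists>g. g \<in> supported (K i) \<and> w i = p g" if "i < ?n" for i
      using PiE_mem[OF w(1), of i] that K(1) by auto
    then obtain g where g: "\<And>i. i < ?n \<Longrightarrow> g i \<in> supported (K i)" "\<And>i. i < ?n \<Longrightarrow> w i = p (g i)"
      by metis
    have gT: "g i \<in> supported T" if "i < ?n" for i using g(1) KT that by blast
    have "p ?e = p (sum g {..<?n})"
      unfolding w(2) by (rule finsum_p) (use g(2) gT in auto)
    moreover have "sum g {..<?n} \<in> supported T" by (rule supported_sum) (use gT in simp)
    ultimately have "?e - sum g {..<?n} \<in> supported L" using p_eq_iff[OF e] by simp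
    then have "Poly_Mapping.lookup (?e - sum g {..<?n}) x = 0"
      using x by (simp add: supported_iff)
    moreover have "Poly_Mapping.lookup (g i) x = 0" if "i < ?n" for i
      using g(1)[OF that] no that by (simp add: supported_iff)
    ultimately show False by (simp add: lookup_minus lookup_sum)
  qed
  have disj: "K i \<inter> K j = {}" if ij: "i < ?n" "j < ?n" "i \<noteq> j" for i j
  proof (rule ccontr)
    assume "K i \<inter> K j \<noteq> {}"
    then obtain x where x: "x \<in> K i" "x \<in> K j" by blast
    let ?e = "Poly_Mapping.single x (1::'k)"
    have xT: "x \<in> T" "x \<notin> L" using x K(2) ij(1) by blast+
    then have e: "?e \<in> supported T" by (simp add: supported_single)
    \<comment> \<open>All of \<open>?e\<close> is placed in slot \<open>k\<close>. For
      \<open>k = i\<close> and \<open>k = j\<close> this gives two expansions of the same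
      element.\<close>
    define w where "w k = (\<lambda>l\<in>{..<?n}. p (if l = k then ?e else 0))" for k
    have W: "w k \<in> ?W \<and> p ?e = (\<Oplus>\<^bsub>M\<^esub>l\<in>{..<?n}. w k l)" if k: "k < ?n" "x \<in> K k" for k
    proof
      show "w k \<in> ?W" unfolding w_def
      proof (rule restrict_PiE[THEN iffD2], rule Pi_I)
        fix l assume "l \<in> {..<?n}"
        then show "p (if l = k then ?e else 0) \<in> ?S l"
          using K(1)[of l] k by (auto simp: supported_single supported_0)
      qed
      have "(\<Oplus>\<^bsub>M\<^esub>l\<in>{..<?n}. w k l) = p (\<Sum>l<?n. if l = k then ?e else 0)"
        by (rule finsum_p) (use e in \<open>auto simp: w_def supported_0\<close>)
      then show "p ?e = (\<Oplus>\<^bsub>M\<^esub>l\<in>{..<?n}. w k l)" using k by simp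
    qed
    have "w i = w j"
      using uniq[of "p ?e"] W[OF ij(1) x(1)] W[OF ij(2) x(2)] e unfolding carrier_eq by blast
    then have "w i i = w j i" by simp
    then have "p ?e = p 0" using ij by (simp add: w_def)
    then show False using p_single_eq_0_iff[OF xT(1), of 1] xT(2) by simp
  qed
  \<comment> \<open>Zero terms have empty support and are dropped, so the partition may have fewer
    parts than \<open>D\<close> has entries.\<close>
  let ?P = "K ` {..<?n} - {{}}"
  have "partition_on (T - L) ?P"
  proof (rule partition_onI)
    have "\<Union>?P = (\<Union>i<?n. K i)" by auto
    also have "\<dots> = T - L"
    proof (intro equalityI subsetI)
      fix x assume "x \<in> (\<Union>i<?n. K i)"
      then obtain i where "i < ?n" "x \<in> K i" by auto
      then show "x \<in> T - L" using K(2)[of i] by blast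
    next
      fix x assume "x \<in> T - L"
      then show "x \<in> (\<Union>i<?n. K i)" using cover[of x] by auto
    qed
    finally show "\<Union>?P = T - L" .
    fix A B assume AB: "A \<in> ?P" "B \<in> ?P" "A \<noteq> B"
    then obtain i j where "A = K i" "B = K j" "i < ?n" "j < ?n" by auto
    then show "disjnt A B" using disj[of i j] AB(3) by (auto simp: disjnt_def)
  qed simp
  moreover have "\<exists>u Z. C = cone u Z" if C: "C \<in> ?P" for C
  proof -
    from C obtain i where "C = K i" "i < ?n" "K i \<noteq> {}" by auto
    then show ?thesis using K(3)[of i] by auto
  qed
  moreover have "card ?P \<le> ?n"
    using card_mono[of "K ` {..<?n}" ?P] card_image_le[of "{..<?n}" K] by simp
  ultimately show ?thesis
    by (intro exI[of _ ?P]) (simp add: cone_partition_def)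
qed

text \<open>The generators are the monomials at the base points of the cones. Restricting a
  representative to each cone gives the expansion; it is unique because the cones are disjoint and
  avoid \<open>L\<close>.\<close>

lemma cone_partition_imp_stanley_decomposition:
  assumes P: "cone_partition (T - L) P"
  shows "\<exists>D. stanley_decomposition M D \<and> length D = card P"
proof -
  have fin: "finite P" and part: "partition_on (T - L) P" using P by (auto simp: cone_partition_def)
  obtain b Z where bZ: "\<And>C. C \<in> P \<Longrightarrow> C = cone (b C) (Z C)"
    using P unfolding cone_partition_def by metis
  obtain Cs where Cs: "set Cs = P" "distinct Cs" using finite_distinct_list[OF fin] by blast
  let ?n = "length Cs"
  define D where "D = map (\<lambda>C. (p (Poly_Mapping.single (b C) 1), Z C)) Cs"
  have CP: "Cs ! i \<in> P" if "i < ?n" for i using that Cs(1) by auto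
  have sub: "C \<subseteq> T - L" if "C \<in> P" for C using that partition_onD1[OF part] by blast
  have bT: "b C \<in> T" if "C \<in> P" for C
    using sub[OF that] bZ[OF that] cone_base[of "b C" "Z C"] by auto
  have S: "stanley_space M (fst (D ! i)) (snd (D ! i)) = p ` supported (Cs ! i)" if "i < ?n" for i
    using that stanley_space_monomial[OF bT[OF CP[OF that]], of 1 "Z (Cs ! i)"] bZ[OF CP[OF that]]
    by (simp add: D_def)
  have T: "f \<in> supported T" if "f \<in> supported (Cs ! i)" "i < ?n" for f i
    using supported_mono[OF that(1)] sub[OF CP[OF that(2)]] by blast
  \<comment> \<open>At an exponent of the cone with index \<open>i\<close> only the summand
    \<open>g i\<close> contributes, by disjointness.\<close>
  have lookup_sum_eq: "Poly_Mapping.lookup (\<Sum>j<?n. g j) u = Poly_Mapping.lookup (g i) u"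
    if g: "\<And>j. j < ?n \<Longrightarrow> g j \<in> supported (Cs ! j)" and i: "i < ?n" "u \<in> Cs ! i"
    for g :: "nat \<Rightarrow> ('n, 'k) mpoly" and i u
  proof -
    have "Poly_Mapping.lookup (g j) u = 0" if j: "j < ?n" "j \<noteq> i" for j
    proof -
      have "Cs ! j \<noteq> Cs ! i" using Cs(2) j i(1) by (simp add: nth_eq_iff_index_eq)
      then have "Cs ! j \<inter> Cs ! i = {}"
        using disjointD[OF partition_onD2[OF part]] CP i(1) j(1) by blast
      then show ?thesis using g[OF j(1)] i(2) by (auto simp: supported_iff)
    qed
    then have "(\<Sum>j<?n. Poly_Mapping.lookup (g j) u) = (\<Sum>j\<in>{i}. Poly_Mapping.lookup (g j) u)"
      using i(1) by (intro sum.mono_neutral_right) auto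
    then show ?thesis by (simp add: lookup_sum)
  qed
  have "\<exists>!w. w \<in> (\<Pi>\<^sub>E i\<in>{..<?n}. p ` supported (Cs ! i)) \<and> v = (\<Oplus>\<^bsub>M\<^esub>i\<in>{..<?n}. w i)"
    if v: "v \<in> carrier M" for v
  proof -
    obtain f where f: "f \<in> supported T" "v = p f" using v by (auto simp: carrier_eq)
    define g where "g i = restrict_poly f (Cs ! i)" for i
    have g: "g i \<in> supported (Cs ! i)" for i by (simp add: g_def restrict_poly_supported)
    show ?thesis
    proof (rule ex1I[of _ "\<lambda>i\<in>{..<?n}. p (g i)"], rule conjI)
      show "(\<lambda>i\<in>{..<?n}. p (g i)) \<in> (\<Pi>\<^sub>E i\<in>{..<?n}. p ` supported (Cs ! i))" using g by auto
      \<comment> \<open>On \<open>T - L\<close> each exponent lies in one cone, where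
        \<open>g i\<close> copies the coefficient of \<open>f\<close>; outside \<open>T\<close> both
        polynomials vanish; on \<open>L\<close> they may differ.\<close>
      have "f - sum g {..<?n} \<in> supported L"
        unfolding supported_iff
      proof (intro allI impI)
        fix u assume u: "u \<notin> L"
        show "Poly_Mapping.lookup (f - sum g {..<?n}) u = 0"
        proof (cases "u \<in> T")
          case True
          then obtain C where C: "C \<in> P" "u \<in> C" using u partition_onD1[OF part] by blast
          then obtain i where i: "i < ?n" "Cs ! i = C" using Cs(1) by (metis in_set_conv_nth)
          show ?thesis
            using lookup_sum_eq[of g i u] g i C(2)
            by (simp add: lookup_minus g_def lookup_restrict_poly)
        next
          case False
          have "sum g {..<?n} \<in> supported T" using T[OF g] by (intro supported_sum) simp
          then show ?thesis using f(1) False by (simp add: lookup_minus supported_iff)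
        qed
      qed
      moreover have "sum g {..<?n} \<in> supported T" by (rule supported_sum) (use T[OF g] in simp)
      ultimately have "p f = p (sum g {..<?n})" using p_eq_iff[OF f(1)] by simp
      also have "\<dots> = (\<Oplus>\<^bsub>M\<^esub>i\<in>{..<?n}. (\<lambda>i\<in>{..<?n}. p (g i)) i)"
        by (rule finsum_p[symmetric]) (use T[OF g] in auto)
      finally show "v = (\<Oplus>\<^bsub>M\<^esub>i\<in>{..<?n}. (\<lambda>i\<in>{..<?n}. p (g i)) i)" using f(2) by simp
    next
      fix w assume w: "w \<in> (\<Pi>\<^sub>E i\<in>{..<?n}. p ` supported (Cs ! i)) \<and> v = (\<Oplus>\<^bsub>M\<^esub>i\<in>{..<?n}. w i)"
      have "\<exists>h. h \<in> supported (Cs ! i) \<and> w i = p h" if "i < ?n" for i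
        using PiE_mem[OF conjunct1[OF w], of i] that by auto
      then obtain h where h: "\<And>i. i < ?n \<Longrightarrow> h i \<in> supported (Cs ! i)"
        "\<And>i. i < ?n \<Longrightarrow> w i = p (h i)"
        by metis
      have hT: "h i \<in> supported T" if "i < ?n" for i using T[OF h(1)[OF that] that] .
      have "p f = (\<Oplus>\<^bsub>M\<^esub>i\<in>{..<?n}. w i)" using w f(2) by simp
      also have "\<dots> = p (sum h {..<?n})"
        by (rule finsum_p) (use h(2) hT in auto)
      finally have "p f = p (sum h {..<?n})" .
      moreover have "sum h {..<?n} \<in> supported T" by (rule supported_sum) (use hT in simp)
      ultimately have L: "f - sum h {..<?n} \<in> supported L" using p_eq_iff[OF f(1)] by simp
      \<comment> \<open>Equality modulo \<open>L\<close> fixes all coefficients on a cone, since no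
        cone meets \<open>L\<close>; off its own cone each summand is zero.\<close>
      have "h i = g i" if i: "i < ?n" for i
      proof (rule poly_mapping_eqI)
        fix u
        show "Poly_Mapping.lookup (h i) u = Poly_Mapping.lookup (g i) u"
        proof (cases "u \<in> Cs ! i")
          case True
          then have "u \<notin> L" using sub[OF CP[OF i]] by blast
          then have "Poly_Mapping.lookup (f - sum h {..<?n}) u = 0"
            using L by (simp add: supported_iff)
          then show ?thesis
            using lookup_sum_eq[of h, OF h(1) i True] True
            by (simp add: lookup_minus g_def lookup_restrict_poly)
        next
          case False
          then show ?thesis using h(1)[OF i] g[of i] by (simp add: supported_iff)
        qed
      qed
      \<comment> \<open>Extensionality settles the values outside the index range.\<close>
      moreover have "w \<in> extensional {..<?n}" using w by (simp add: PiE_def)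
      ultimately show "w = (\<lambda>i\<in>{..<?n}. p (g i))"
        by (intro extensionalityI[of _ "{..<?n}"]) (auto simp: h(2))
    qed
  qed
  moreover have lenD: "length D = ?n" by (simp add: D_def)
  moreover have "(\<Pi>\<^sub>E i\<in>{..<?n}. stanley_space M (fst (D ! i)) (snd (D ! i))) =
      (\<Pi>\<^sub>E i\<in>{..<?n}. p ` supported (Cs ! i))"
    by (rule PiE_cong) (simp add: S)
  moreover have "m \<in> carrier M \<and> homogeneous M m \<and>
      free_over M (poly_subring Z') (stanley_space M m Z')" if mZ: "(m, Z') \<in> set D" for m Z'
  proof -
    obtain C where C: "C \<in> P" "m = p (Poly_Mapping.single (b C) 1)" "Z' = Z C"
      using mZ Cs(1) by (auto simp: D_def)
    have "cone (b C) (Z C) \<subseteq> T - L" using sub[OF C(1)] bZ[OF C(1)] by simp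
    then have "free_over M (poly_subring Z') (stanley_space M m Z')"
      using free_over_cone C by simp
    moreover have "Poly_Mapping.single (b C) 1 \<in>
        supported T \<inter> poly_component (exponent_degree (b C))"
      using bT[OF C(1)] by (simp add: supported_single poly_component_alt)
    ultimately show ?thesis
      unfolding homogeneous_def component_eq carrier_eq C(2) by blast
  qed
  ultimately have "stanley_decomposition M D"
    unfolding stanley_decomposition_def by (auto simp del: split_paired_All)
  moreover have "length D = card P" using distinct_card[OF Cs(2)] Cs(1) lenD by simp
  ultimately show ?thesis by blast
qed

section \<open>Stanley length as the least number of cones\<close>

lemma slength_le_card:
  assumes "cone_partition (T - L) P"
  shows "slength M \<le> card P"
  unfolding slength_def
  by (rule Least_le) (rule cone_partition_imp_stanley_decomposition[OF assms])

text \<open>\<open>LEAST\<close> is meaningful only once some decomposition exists. Intersecting a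
  partition of \<open>T\<close> with one of \<open>- L\<close> supplies it; then a shortest
  decomposition is turned back into a partition.\<close>

lemma slength_attained: "\<exists>P. cone_partition (T - L) P \<and> card P \<le> slength M"
proof -
  obtain P Q where "cone_partition T P" "cone_partition (- L) Q"
    using ex_cone_partition upward by meson
  then obtain R where "cone_partition (T - L) R"
    using cone_partition_Int by (metis Diff_eq)
  then have "\<exists>r D. stanley_decomposition M D \<and> length D = r"
    using cone_partition_imp_stanley_decomposition by blast
  then have "\<exists>D. stanley_decomposition M D \<and> length D = slength M"
    unfolding slength_def by (rule LeastI_ex)
  then show ?thesis using stanley_decomposition_imp_cone_partition by metis
qed

end

section \<open>Ideals and quotient rings as subquotients\<close>

text \<open>An ideal is its own quotient by zero, the ideal with no exponents.\<close>

lemma monomial_subquotient_ideal_module: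
  fixes E :: "('n::finite \<Rightarrow>\<^sub>0 nat) set"
  assumes E: "upward_closed E"
  shows "monomial_subquotient (ideal_module (supported E :: ('n, 'k::field) mpoly set)) id E {}"
proof -
  let ?I = "supported E :: ('n, 'k) mpoly set"
  have I: "monomial_ideal ?I" using E monomial_ideal_iff by blast
  have "f \<in> supported {} \<longleftrightarrow> f = 0" for f :: "('n, 'k) mpoly"
    by (auto simp: supported_def)
  moreover have "upward_closed {}" by (simp add: upward_closed_def)
  ultimately show ?thesis
    using E by (intro monomial_subquotient.intro[OF module_ideal_module[OF I]]
        monomial_subquotient_axioms.intro)
      (simp_all add: ideal_module_def)
qed

text \<open>Here the whole ring is divided by the ideal, and \<open>p\<close> is the coset map; the
  basis is indexed by \<open>- E\<close>.\<close>

lemma monomial_subquotient_quotient_module: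
  fixes E :: "('n::finite \<Rightarrow>\<^sub>0 nat) set"
  assumes E: "upward_closed E"
  shows "monomial_subquotient (quotient_module (supported E :: ('n, 'k::field) mpoly set))
    (\<lambda>f. supported E +>\<^bsub>poly_ring\<^esub> f) UNIV E"
proof -
  let ?I = "supported E :: ('n, 'k) mpoly set"
  have I: "monomial_ideal ?I" using E monomial_ideal_iff by blast
  have "supported UNIV = (UNIV :: ('n, 'k) mpoly set)" by (simp add: supported_def)
  moreover have "upward_closed UNIV" by (simp add: upward_closed_def)
  ultimately show ?thesis
    using E by (intro monomial_subquotient.intro[OF module_quotient_module[OF I]]
        monomial_subquotient_axioms.intro)
      (simp_all add: quotient_module_simps[OF I] coset_eq_iff[OF I])
qed

section \<open>Stanley length of sums and intersections\<close>

theorem proposition2p6: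
  fixes I J :: "('n::finite, 'k::field) mpoly set" and r r' s s' :: nat
  assumes "monomial_ideal I" and "monomial_ideal J"
    and "r = slength (ideal_module I)" and "r' = slength (quotient_module I)"
    and "s = slength (ideal_module J)" and "s' = slength (quotient_module J)"
  shows "slength (ideal_module (I \<inter> J)) \<le> r * s \<and>
    slength (ideal_module (I <+>\<^bsub>poly_ring\<^esub> J)) \<le> min (r + s * r') (s + r * s') \<and>
    slength (quotient_module (I <+>\<^bsub>poly_ring\<^esub> J)) \<le> r' * s' \<and>
    slength (quotient_module (I \<inter> J)) \<le> min (r' + r * s') (s' + s * r')"
proof -
  obtain E F where E: "upward_closed E" "I = supported E" and F: "upward_closed F" "J = supported F"
    using assms(1,2) unfolding monomial_ideal_iff by blast
  note ideal = monomial_subquotient_ideal_module[where 'k = 'k]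
    and quotient = monomial_subquotient_quotient_module[where 'k = 'k]
  \<comment> \<open>The difference \<open>T - L\<close> becomes \<open>E\<close> for ideals and
    \<open>- E\<close> for quotients.\<close>
  note le_I = monomial_subquotient.slength_le_card[OF ideal, unfolded Diff_empty]
    and le_Q = monomial_subquotient.slength_le_card[OF quotient, folded Compl_eq_Diff_UNIV]
    and att_I = monomial_subquotient.slength_attained[OF ideal, unfolded Diff_empty]
    and att_Q = monomial_subquotient.slength_attained[OF quotient, folded Compl_eq_Diff_UNIV]
  obtain P where P: "cone_partition E P" "card P \<le> r"
    using att_I[OF E(1)] assms(3) E(2) by blast
  obtain P' where P': "cone_partition (- E) P'" "card P' \<le> r'"
    using att_Q[OF E(1)] assms(4) E(2) by blast
  obtain Q where Q: "cone_partition F Q" "card Q \<le> s"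
    using att_I[OF F(1)] assms(5) F(2) by blast
  obtain Q' where Q': "cone_partition (- F) Q'" "card Q' \<le> s'"
    using att_Q[OF F(1)] assms(6) F(2) by blast
  have inter: "\<exists>R. cone_partition (A \<inter> B) R \<and> card R \<le> a * b"
    if "cone_partition A X" "card X \<le> a" "cone_partition B Y" "card Y \<le> b"
    for A B :: "('n \<Rightarrow>\<^sub>0 nat) set" and X Y a b
    using cone_partition_Int[OF that(1,3)] mult_le_mono[OF that(2,4)] le_trans by blast
  \<comment> \<open>Only the part of \<open>B\<close> outside \<open>A\<close> is added to
    \<open>A\<close>; refining its partition by one of \<open>- A\<close> costs at most
    \<open>b * c\<close> cones.\<close>
  have union: "\<exists>R. cone_partition (A \<union> B) R \<and> card R \<le> a + b * c"
    if A: "cone_partition A X" "card X \<le> a" and B: "cone_partition B Y" "card Y \<le> b"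
      and C: "cone_partition (- A) X'" "card X' \<le> c"
    for A B :: "('n \<Rightarrow>\<^sub>0 nat) set" and X Y X' a b c
  proof -
    obtain R where R: "cone_partition (B \<inter> - A) R" "card R \<le> b * c" using inter[OF B C] by blast
    have "cone_partition (A \<union> B) (X \<union> R)"
      using cone_partition_Un[OF A(1) R(1)] by (simp add: Un_Int_distrib Int_absorb)
    moreover have "card (X \<union> R) \<le> a + b * c"
      using card_Un_le[of X R] A(2) R(2) by linarith
    ultimately show ?thesis by blast
  qed
  note Int = upward_closed_Int[OF E(1) F(1)] and Un = upward_closed_Un[OF E(1) F(1)]
  have "slength (ideal_module (I \<inter> J)) \<le> r * s"
    using inter[OF P Q] le_I[OF Int] unfolding E(2) F(2) supported_Int by (meson le_trans)
  moreover have "slength (ideal_module (I <+>\<^bsub>poly_ring\<^esub> J)) \<le> r + s * r'"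
    using union[OF P Q P'] le_I[OF Un] unfolding E(2) F(2) supported_set_add by (meson le_trans)
  moreover have "slength (ideal_module (I <+>\<^bsub>poly_ring\<^esub> J)) \<le> s + r * s'"
    using union[OF Q P Q'] le_I[OF Un] unfolding E(2) F(2) supported_set_add Un_commute[of F E]
    by (meson le_trans)
  moreover have "slength (quotient_module (I <+>\<^bsub>poly_ring\<^esub> J)) \<le> r' * s'"
    using inter[OF P' Q'] le_Q[OF Un] unfolding E(2) F(2) supported_set_add Compl_Un
    by (meson le_trans)
  moreover have "slength (quotient_module (I \<inter> J)) \<le> r' + r * s'"
  proof -
    \<comment> \<open>The complement of \<open>- E\<close> is \<open>E\<close>, so \<open>P\<close>
      itself refines the partition of \<open>- F\<close>.\<close>
    obtain R where "cone_partition (- E \<union> - F) R" "card R \<le> r' + s' * r"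
      using union[OF P' Q', of P r] P by auto
    then show ?thesis
      using le_Q[OF Int, of R] unfolding E(2) F(2) supported_Int Compl_Int by (simp add: mult.commute)
  qed
  moreover have "slength (quotient_module (I \<inter> J)) \<le> s' + s * r'"
  proof -
    obtain R where "cone_partition (- F \<union> - E) R" "card R \<le> s' + r' * s"
      using union[OF Q' P', of Q s] Q by auto
    then show ?thesis
      using le_Q[OF Int, of R] unfolding E(2) F(2) supported_Int Compl_Int
      by (simp add: mult.commute Un_commute)
  qed
  ultimately show ?thesis by simp
qed

end
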